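(* Let $G$ be a 2-connected $\{K_{1,3},S\}$-$o$-heavy graph, where $S\in\{P_4,P_5,C_3,Z_1,Z_2,B,N\}$. Then $cl_c(G)$ is claw-free and $N$-$p$-heavy.
   Context: All graphs are finite, simple and undirected; $n=|V(G)|$ and $d(v)$ denotes the degree of $v$ in $G$. A pair of nonadjacent vertices $\{u,v\}$ is an $o$-heavy pair if $d(u)+d(v)\ge n$; an adjacent pair $\{u,v\}$ with $d(u)+d(v)\ge n$ is an $a$-heavy pair; a vertex $u$ is heavy if $d(u)\ge n/2$. For a graph $H$, $G$ is $H$-$o$-heavy if every induced subgraph of $G$ isomorphic to $H$ contains an $o$-heavy pair of $G$; for a family $\mathcal H$, $G$ is $\mathcal H$-$o$-heavy if it is $H$-$o$-heavy for every $H\in\mathcal H$. $K_{1,3}$ is the claw; $P_k$ and $C_k$ are the path and cycle on $k$ vertices; $Z_k$ is obtained by identifying a vertex of a $C_3$ with an end-vertex of a $P_{k+1}$; $B$ (bull) is a triangle with a pendant edge attached at two of its vertices; $N$ (net) is a triangle $a_1a_2a_3$ with pendant vertices $b_1,b_2,b_3$, where $b_i$ is adjacent only to $a_i$. An induced net of $G$ is $p$-heavy if its triangle $a_1a_2a_3$ contains an $a$-heavy pair of $G$; $G$ is $N$-$p$-heavy if every induced net of $G$ is $p$-heavy. $cl_c(G)$ is Čada's closure of a claw-$o$-heavy graph $G$: for $x\in V(G)$, let $G^{BC}_x$ be $G$ plus all edges $uv$ with $u,v\in N(x)$, $uv\notin E(G)$, $d(u)+d(v)\ge n$. A vertex $x$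 is $c$-eligible if $N(x)$ is not a clique in $G^{BC}_x$ and either (i) $G^{BC}_x[N(x)]$ is connected, or (ii) $G^{BC}_x[N(x)]$ is the disjoint union of two cliques $C_1,C_2$ and $x$ lies in an $o$-heavy pair $\{x,z\}$ of $G$ with $zy_1,zy_2\in E(G)$ for some $y_1\in C_1$, $y_2\in C_2$. The local completion at a $c$-eligible $x$ adds all edges between vertices of $N(x)$; $cl_c(G)$ is obtained by repeating local completions at $c$-eligible vertices until none remain (it is uniquely determined, and equals the minimum $\{K_{1,3},\text{diamond}\}$-free spanning supergraph of $G$ with no $o$-heavy pair).
   Formalization: In the definition of a c-eligible vertex x, "N(x) is not a clique" is taken in G itself, not in G^{BC}_x; with the latter wording K_{3,3} would be its own closure and the claim would fail. The result is stated for every terminal graph of the local completions. *)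

theory Defs
  imports Main
begin

record 'a ugraph =
  verts :: "'a set"
  edges :: "'a set set"

definition simple_graph :: "'a ugraph \<Rightarrow> bool" where
  "simple_graph G \<longleftrightarrow>
     finite (verts G) \<and> (\<forall>e\<in>edges G. e \<subseteq> verts G \<and> card e = 2)"

definition adj :: "'a ugraph \<Rightarrow> 'a \<Rightarrow> 'a \<Rightarrow> bool" where
  "adj G u v \<longleftrightarrow> {u, v} \<in> edges G"

definition nbhd :: "'a ugraph \<Rightarrow> 'a \<Rightarrow> 'a set" where
  "nbhd G x = {y. adj G x y}"

definition deg :: "'a ugraph \<Rightarrow> 'a \<Rightarrow> nat" where
  "deg G x = card (nbhd G x)"

definition induced_subgraph :: "'a ugraph \<Rightarrow> 'a set \<Rightarrow> 'a ugraph" where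
  "induced_subgraph G A = \<lparr>verts = A, edges = {e \<in> edges G. e \<subseteq> A}\<rparr>"

definition graph_iso :: "('a \<Rightarrow> 'b) \<Rightarrow> 'a ugraph \<Rightarrow> 'b ugraph \<Rightarrow> bool" where
  "graph_iso f G H \<longleftrightarrow>
     bij_betw f (verts G) (verts H) \<and>
     (\<forall>u\<in>verts G. \<forall>v\<in>verts G. adj G u v \<longleftrightarrow> adj H (f u) (f v))"

definition isomorphic :: "'a ugraph \<Rightarrow> 'b ugraph \<Rightarrow> bool" where
  "isomorphic G H \<longleftrightarrow> (\<exists>f. graph_iso f G H)"

definition connected_graph :: "'a ugraph \<Rightarrow> bool" where
  "connected_graph G \<longleftrightarrow>
     verts G \<noteq> {} \<and> (\<forall>u\<in>verts G. \<forall>v\<in>verts G. (adj G)\<^sup>*\<^sup>* u v)"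

definition two_connected :: "'a ugraph \<Rightarrow> bool" where
  "two_connected G \<longleftrightarrow>
     card (verts G) \<ge> 3 \<and> connected_graph G \<and>
     (\<forall>v\<in>verts G. connected_graph (induced_subgraph G (verts G - {v})))"

definition is_clique :: "'a ugraph \<Rightarrow> 'a set \<Rightarrow> bool" where
  "is_clique G A \<longleftrightarrow> (\<forall>u\<in>A. \<forall>v\<in>A. u \<noteq> v \<longrightarrow> adj G u v)"

definition path_graph :: "nat \<Rightarrow> nat ugraph" where
  "path_graph k = \<lparr>verts = {..<k}, edges = {{i, Suc i} |i. Suc i < k}\<rparr>"

text \<open>Only meaningful for \<open>k \<ge> 3\<close>.\<close>
definition cycle_graph :: "nat \<Rightarrow> nat ugraph" where
  "cycle_graph k = \<lparr>verts = {..<k}, edges = {{i, Suc i mod k} |i. i < k}\<rparr>"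

text \<open>The triangle is on 0, 1, 2; the path with \<open>k + 1\<close> vertices is 2, 3, ..., \<open>k + 2\<close>.\<close>
definition Z_graph :: "nat \<Rightarrow> nat ugraph" where
  "Z_graph k = \<lparr>verts = {..<k + 3},
     edges = {{0, 1}, {1, 2}, {0, 2}} \<union> {{i, Suc i} |i. 2 \<le> i \<and> i < k + 2}\<rparr>"

definition claw :: "nat ugraph" where
  "claw = \<lparr>verts = {0, 1, 2, 3}, edges = {{0, 1}, {0, 2}, {0, 3}}\<rparr>"

definition bull :: "nat ugraph" where
  "bull = \<lparr>verts = {0, 1, 2, 3, 4},
     edges = {{0, 1}, {1, 2}, {0, 2}, {0, 3}, {1, 4}}\<rparr>"

text \<open>The triangle is 0, 1, 2, and vertex \<open>i + 3\<close> is the pendant neighbour of \<open>i\<close>.\<close>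
definition net :: "nat ugraph" where
  "net = \<lparr>verts = {0, 1, 2, 3, 4, 5},
     edges = {{0, 1}, {1, 2}, {0, 2}, {0, 3}, {1, 4}, {2, 5}}\<rparr>"

definition o_heavy_pair :: "'a ugraph \<Rightarrow> 'a \<Rightarrow> 'a \<Rightarrow> bool" where
  "o_heavy_pair G u v \<longleftrightarrow>
     u \<in> verts G \<and> v \<in> verts G \<and> u \<noteq> v \<and> \<not> adj G u v \<and>
     deg G u + deg G v \<ge> card (verts G)"

definition a_heavy_pair :: "'a ugraph \<Rightarrow> 'a \<Rightarrow> 'a \<Rightarrow> bool" where
  "a_heavy_pair G u v \<longleftrightarrow> adj G u v \<and> deg G u + deg G v \<ge> card (verts G)"

definition o_heavy :: "'b ugraph \<Rightarrow> 'a ugraph \<Rightarrow> bool" where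
  "o_heavy H G \<longleftrightarrow>
     (\<forall>A\<subseteq>verts G. isomorphic H (induced_subgraph G A) \<longrightarrow>
        (\<exists>u\<in>A. \<exists>v\<in>A. o_heavy_pair G u v))"

definition family_o_heavy :: "'b ugraph set \<Rightarrow> 'a ugraph \<Rightarrow> bool" where
  "family_o_heavy \<H> G \<longleftrightarrow> (\<forall>H\<in>\<H>. o_heavy H G)"

definition claw_free :: "'a ugraph \<Rightarrow> bool" where
  "claw_free G \<longleftrightarrow> (\<forall>A\<subseteq>verts G. \<not> isomorphic claw (induced_subgraph G A))"

definition N_p_heavy :: "'a ugraph \<Rightarrow> bool" where
  "N_p_heavy G \<longleftrightarrow>
     (\<forall>A\<subseteq>verts G. \<forall>f. graph_iso f net (induced_subgraph G A) \<longrightarrow>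
        (\<exists>i\<in>{0, 1, 2}. \<exists>j\<in>{0, 1, 2}. a_heavy_pair G (f i) (f j)))"

definition BC_graph :: "'a ugraph \<Rightarrow> 'a \<Rightarrow> 'a ugraph" where
  "BC_graph G x = G\<lparr>edges := edges G \<union>
     {{u, v} |u v. u \<in> nbhd G x \<and> v \<in> nbhd G x \<and> u \<noteq> v \<and> \<not> adj G u v \<and>
                   deg G u + deg G v \<ge> card (verts G)}\<rparr>"

text \<open>
  The requirement that \<open>nbhd G x\<close> is not a clique refers to \<open>G\<close> itself (Cada's
  definition), not to \<open>BC_graph G x\<close>.  With the latter no vertex of \<open>K\<^bsub>3,3\<^esub>\<close> would be
  eligible, so \<open>K\<^bsub>3,3\<^esub>\<close> would be its own closure although it contains claws and
  o-heavy pairs.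
\<close>
definition c_eligible :: "'a ugraph \<Rightarrow> 'a \<Rightarrow> bool" where
  "c_eligible G x \<longleftrightarrow>
     x \<in> verts G \<and> \<not> is_clique G (nbhd G x) \<and>
     (connected_graph (induced_subgraph (BC_graph G x) (nbhd G x)) \<or>
      (\<exists>C\<^sub>1 C\<^sub>2 z.
         C\<^sub>1 \<union> C\<^sub>2 = nbhd G x \<and> C\<^sub>1 \<inter> C\<^sub>2 = {} \<and>
         is_clique (BC_graph G x) C\<^sub>1 \<and> is_clique (BC_graph G x) C\<^sub>2 \<and>
         (\<forall>u\<in>C\<^sub>1. \<forall>v\<in>C\<^sub>2. \<not> adj (BC_graph G x) u v) \<and>
         o_heavy_pair G x z \<and> (\<exists>y\<^sub>1\<in>C\<^sub>1. adj G z y\<^sub>1) \<and> (\<exists>y\<^sub>2\<in>C\<^sub>2. adj G z y\<^sub>2)))"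

definition local_completion :: "'a ugraph \<Rightarrow> 'a \<Rightarrow> 'a ugraph" where
  "local_completion G x = G\<lparr>edges := edges G \<union>
     {{u, v} |u v. u \<in> nbhd G x \<and> v \<in> nbhd G x \<and> u \<noteq> v}\<rparr>"

definition closure_step :: "'a ugraph \<Rightarrow> 'a ugraph \<Rightarrow> bool" where
  "closure_step G G' \<longleftrightarrow> (\<exists>x. c_eligible G x \<and> G' = local_completion G x)"

text \<open>
  \<open>is_cl_c G H\<close>: the graph \<open>H\<close> is a result of performing local completions at
  c-eligible vertices, starting from \<open>G\<close>, until none remain (degrees and eligibility are
  taken in the current graph).
\<close>
definition is_cl_c :: "'a ugraph \<Rightarrow> 'a ugraph \<Rightarrow> bool" where
  "is_cl_c G H \<longleftrightarrow> closure_step\<^sup>*\<^sup>* G H \<and> (\<forall>x\<in>verts H. \<not> c_eligible H x)"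

lemma simple_graph_local_completion:
  assumes "simple_graph G"
  shows "simple_graph (local_completion G x)"
proof -
  have "nbhd G x \<subseteq> verts G"
    using assms by (auto simp: simple_graph_def nbhd_def adj_def)
  then show ?thesis
    using assms by (auto simp: simple_graph_def local_completion_def)
qed

lemma ex_is_cl_c:
  assumes "simple_graph G"
  shows "\<exists>H. is_cl_c G H"
  using assms
proof (induction "card (Pow (verts G) - edges G)" arbitrary: G rule: less_induct)
  case less
  show ?case
  proof (cases "\<exists>x\<in>verts G. c_eligible G x")
    case False
    then show ?thesis by (auto simp: is_cl_c_def)
  next
    case True
    then obtain x where x: "c_eligible G x" by blast
    let ?G = "local_completion G x"
    obtain u v where uv: "u \<in> nbhd G x" "v \<in> nbhd G x" "u \<noteq> v" "{u, v} \<notin> edges G"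
      using x unfolding c_eligible_def is_clique_def adj_def by blast
    have sub: "nbhd G x \<subseteq> verts G"
      using less.prems by (auto simp: simple_graph_def nbhd_def adj_def)
    have "Pow (verts ?G) - edges ?G \<subseteq> Pow (verts G) - edges G"
      by (auto simp: local_completion_def)
    moreover have "{u, v} \<in> Pow (verts G) - edges G"
      using uv sub by auto
    moreover have "{u, v} \<notin> Pow (verts ?G) - edges ?G"
      using uv by (auto simp: local_completion_def)
    ultimately have "Pow (verts ?G) - edges ?G \<subset> Pow (verts G) - edges G"
      by (metis psubsetI)
    then have "card (Pow (verts ?G) - edges ?G) < card (Pow (verts G) - edges G)"
      using less.prems by (intro psubset_card_mono) (auto simp: simple_graph_def)
    then obtain H where "is_cl_c ?G H"
      using less.hyps simple_graph_local_completion[OF less.prems] by blast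
    moreover have "closure_step G ?G"
      using x by (auto simp: closure_step_def)
    ultimately have "is_cl_c G H"
      unfolding is_cl_c_def by (blast intro: converse_rtranclp_into_rtranclp)
    then show ?thesis ..
  qed
qed

end

theory Submission
  imports Defs
begin

text \<open>
  The closure \<open>H\<close> has no o-heavy pair and is claw-free and diamond-free, so its maximal cliques meet
  in at most one vertex; and any two \<open>H\<close>-adjacent vertices are joined in \<open>G\<close> by a path whose inner
  vertices are simplicial in \<open>H\<close> and lie in the same maximal clique. Given an induced net of \<open>H\<close>
  whose triangle \<open>a b c\<close> has no a-heavy pair, simplicial vertices of the clique of the triangle have
  degree at most that of \<open>a\<close>, \<open>b\<close>, \<open>c\<close>; hence connecting \<open>a\<close>, \<open>b\<close>, \<open>c\<close> in \<open>G\<close> through such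
  vertices gives an induced net of \<open>G\<close> without o-heavy pair. This settles the net and the graphs
  contained in it. For P5 and Z2 one may moreover assume that \<open>a b c\<close> is a triangle of \<open>G\<close>, and
  leaves the triangle along two of the cliques at its corners, using 2-connectedness; for Z2 a single
  configuration (\<open>theta\<close> below) survives and is excluded by counting degrees.
\<close>

section \<open>Elementary facts on the graph operations\<close>

text \<open>Degrees only grow under completion and \<open>H\<close> has no o-heavy pair, so distinct
  vertices nonadjacent in \<open>H\<close> are nonadjacent in \<open>G\<close> with degree sum below
  \<open>n\<close> there (\<open>light\<close>). A pattern seen in \<open>H\<close> can therefore be
  used in \<open>G\<close>, except for pairs that are edges of \<open>H\<close> but not of
  \<open>G\<close>: such a pair may be o-heavy in \<open>G\<close>, and then o-heaviness of
  \<open>S\<close> excludes nothing. These pairs arise in two places. Within the clique of the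
  triangle the missing a-heavy pair bounds the relevant degrees. Within the cliques at the corners
  (\<open>side\<close>) there is no such bound, but at most one of the three corners can have an
  o-heavy partner in its side (\<open>light_side\<close>). The P5 argument uses one good corner, the
  Z2 argument two; the third, uncontrolled corner leaves room for \<open>theta\<close>. There
  heaviness is turned against the configuration: heavy pairs force common neighbours, and these in
  turn miss too many vertices.\<close>

lemma adj_sym: "adj G u v \<longleftrightarrow> adj G v u"
  by (simp add: adj_def insert_commute)

lemma adj_irrefl: "simple_graph G \<Longrightarrow> \<not> adj G u u"
  by (auto simp: simple_graph_def adj_def)

lemma adj_verts: "simple_graph G \<Longrightarrow> adj G u v \<Longrightarrow> u \<in> verts G \<and> v \<in> verts G"
  by (auto simp: simple_graph_def adj_def)

lemma nbhd_subset_verts: "simple_graph G \<Longrightarrow> nbhd G x \<subseteq> verts G"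
  by (auto simp: nbhd_def adj_verts)

lemma finite_nbhd: "simple_graph G \<Longrightarrow> finite (nbhd G x)"
  using nbhd_subset_verts finite_subset simple_graph_def by metis

lemma adj_induced_subgraph:
  "adj (induced_subgraph G A) u v \<longleftrightarrow> adj G u v \<and> u \<in> A \<and> v \<in> A"
  by (auto simp: induced_subgraph_def adj_def)

lemma adj_local_completion:
  "adj (local_completion G x) u v \<longleftrightarrow> adj G u v \<or> (adj G x u \<and> adj G x v \<and> u \<noteq> v)"
  by (auto simp: local_completion_def adj_def nbhd_def doubleton_eq_iff insert_commute)

lemma adj_BC_graph:
  "adj (BC_graph G x) u v \<longleftrightarrow>
     adj G u v \<or> (adj G x u \<and> adj G x v \<and> u \<noteq> v \<and> deg G u + deg G v \<ge> card (verts G))"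
  by (auto simp: BC_graph_def adj_def nbhd_def doubleton_eq_iff insert_commute add.commute)

lemma verts_local_completion [simp]: "verts (local_completion G x) = verts G"
  by (simp add: local_completion_def)

lemma verts_induced_subgraph [simp]: "verts (induced_subgraph G A) = A"
  by (simp add: induced_subgraph_def)

lemma o_heavy_pair_sym: "o_heavy_pair G u v \<longleftrightarrow> o_heavy_pair G v u"
  by (auto simp: o_heavy_pair_def adj_sym add.commute)

lemma deg_mono:
  assumes "simple_graph H" "\<And>u v. adj G u v \<Longrightarrow> adj H u v"
  shows "deg G u \<le> deg H u"
  unfolding deg_def by (rule card_mono[OF finite_nbhd[OF assms(1)]]) (auto simp: nbhd_def assms(2))

lemma o_heavyD:
  assumes "o_heavy H G" "inj_on f (verts H)" "\<And>i. i \<in> verts H \<Longrightarrow> f i \<in> verts G"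
    and "\<And>i j. i \<in> verts H \<Longrightarrow> j \<in> verts H \<Longrightarrow> adj G (f i) (f j) \<longleftrightarrow> adj H i j"
  shows "\<exists>i\<in>verts H. \<exists>j\<in>verts H. o_heavy_pair G (f i) (f j)"
proof -
  have "graph_iso f H (induced_subgraph G (f ` verts H))"
    using assms(2,4) by (auto simp: graph_iso_def bij_betw_def adj_induced_subgraph)
  then have "isomorphic H (induced_subgraph G (f ` verts H))"
    unfolding isomorphic_def by blast
  moreover have "f ` verts H \<subseteq> verts G" using assms(3) by blast
  ultimately show ?thesis using assms(1) unfolding o_heavy_def by blast
qed

section \<open>The closure of a claw-o-heavy graph\<close>

text \<open>The claw condition without isomorphisms. Pairs containing the centre \<open>c\<close>
  are absent because they are edges and cannot be o-heavy.\<close>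

definition claws_heavy :: "'a ugraph \<Rightarrow> bool" where
  "claws_heavy G \<longleftrightarrow> (\<forall>c u v w. adj G c u \<and> adj G c v \<and> adj G c w \<and> u \<noteq> v \<and> v \<noteq> w \<and> u \<noteq> w \<and>
      \<not> adj G u v \<and> \<not> adj G v w \<and> \<not> adj G u w \<longrightarrow>
      o_heavy_pair G u v \<or> o_heavy_pair G v w \<or> o_heavy_pair G u w)"

lemma claws_heavyD:
  "claws_heavy G \<Longrightarrow> adj G c u \<Longrightarrow> adj G c v \<Longrightarrow> adj G c w \<Longrightarrow> u \<noteq> v \<Longrightarrow> v \<noteq> w \<Longrightarrow> u \<noteq> w \<Longrightarrow>
   \<not> adj G u v \<Longrightarrow> \<not> adj G v w \<Longrightarrow> \<not> adj G u w \<Longrightarrow>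
   o_heavy_pair G u v \<or> o_heavy_pair G v w \<or> o_heavy_pair G u w"
  unfolding claws_heavy_def by blast

lemma claws_heavy_if_o_heavy_claw:
  assumes "simple_graph G" "o_heavy claw G"
  shows "claws_heavy G"
  unfolding claws_heavy_def
proof (intro allI impI, elim conjE)
  fix c u v w
  assume a: "adj G c u" "adj G c v" "adj G c w" "u \<noteq> v" "v \<noteq> w" "u \<noteq> w"
    "\<not> adj G u v" "\<not> adj G v w" "\<not> adj G u w"
  define f where "f = (\<lambda>i::nat. if i = 0 then c else if i = 1 then u else if i = 2 then v else w)"
  have ne: "c \<noteq> u" "c \<noteq> v" "c \<noteq> w"
    using a adj_irrefl[OF assms(1)] by auto
  have V: "{c, u, v, w} \<subseteq> verts G"
    using a adj_verts[OF assms(1)] by blast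
  have 1: "inj_on f (verts claw)"
    using a ne by (auto simp: inj_on_def f_def claw_def)
  have 2: "\<exists>i\<in>verts claw. \<exists>j\<in>verts claw. o_heavy_pair G (f i) (f j)"
  proof (rule o_heavyD[OF assms(2) 1])
    fix i assume "i \<in> verts claw"
    then show "f i \<in> verts G" using V by (auto simp: f_def)
  next
    fix i j assume "i \<in> verts claw" "j \<in> verts claw"
    then show "adj G (f i) (f j) \<longleftrightarrow> adj claw i j"
      using a adj_irrefl[OF assms(1)]
      by (auto simp: f_def claw_def adj_sym[of G _ c] adj_sym[of G v u] adj_sym[of G w v] adj_sym[of G w u]
          doubleton_eq_iff adj_def[of "\<lparr>verts = _, edges = _\<rparr>"])
  qed
  then show "o_heavy_pair G u v \<or> o_heavy_pair G v w \<or> o_heavy_pair G u w"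
    using a ne by (auto simp: f_def claw_def o_heavy_pair_sym[of G v u] o_heavy_pair_sym[of G w v]
        o_heavy_pair_sym[of G w u]) (auto simp: o_heavy_pair_def adj_sym)
qed

text \<open>At most one edge of a claw of the new graph is new, since the leaves of two new edges
  both lie in \<open>N(x)\<close> and would be joined. If \<open>c u\<close> is new, then
  \<open>c\<close> with leaves \<open>x\<close>, \<open>v\<close>, \<open>w\<close> is a claw of
  \<open>G\<close>; a heavy pair containing \<open>x\<close> passes to \<open>u\<close>, whose new
  degree is at least the old degree of \<open>x\<close> (\<open>dx\<close>).\<close>

lemma claws_heavy_local_completion:
  assumes "simple_graph G" "claws_heavy G"
  shows "claws_heavy (local_completion G x)"
proof -
  let ?G = "local_completion G x"
  note sg = simple_graph_local_completion[OF assms(1), of x]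
  have sub: "adj G u v \<Longrightarrow> adj ?G u v" for u v by (simp add: adj_local_completion)
  have dm: "deg G u \<le> deg ?G u" for u by (rule deg_mono[OF sg sub])
  have up: "o_heavy_pair ?G u v" if "o_heavy_pair G u v" "\<not> adj ?G u v" for u v
    using that dm[of u] dm[of v] by (auto simp: o_heavy_pair_def)
  have dx: "deg G x \<le> deg ?G u" if "adj G x u" for u
  proof -
    have s: "insert x (nbhd G x - {u}) \<subseteq> nbhd ?G u"
      using that by (auto simp: nbhd_def adj_local_completion adj_sym)
    have "card (insert x (nbhd G x - {u})) = deg G x"
      using that finite_nbhd[OF assms(1), of x] adj_irrefl[OF assms(1), of x]
      by (simp add: nbhd_def deg_def card_Diff_singleton_if) (metis card_gt_0_iff empty_iff mem_Collect_eq Suc_pred)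
    then show ?thesis
      using card_mono[OF finite_nbhd[OF sg] s] by (simp add: deg_def)
  qed
  have core: "o_heavy_pair ?G u v \<or> o_heavy_pair ?G v w \<or> o_heavy_pair ?G u w"
    if a: "adj G x c" "adj G x u" "adj G c v" "adj G c w" "u \<noteq> v" "v \<noteq> w" "u \<noteq> w"
      "\<not> adj ?G u v" "\<not> adj ?G v w" "\<not> adj ?G u w" for c u v w
  proof -
    have n: "\<not> adj G x v" "\<not> adj G x w" "x \<noteq> v" "x \<noteq> w" "\<not> adj G v w"
      using a by (auto simp: adj_local_completion adj_sym)
    have "o_heavy_pair G x v \<or> o_heavy_pair G v w \<or> o_heavy_pair G x w"
      using claws_heavyD[OF assms(2), of c x v w] a n by (auto simp: adj_sym)
    then show ?thesis
      using up[of v w] a dx[of u] dm[of v] dm[of w] adj_verts[OF assms(1), of x u]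
      by (auto simp: o_heavy_pair_def)
  qed
  have half: "o_heavy_pair ?G u v \<or> o_heavy_pair ?G v w \<or> o_heavy_pair ?G u w"
    if a: "adj ?G c u" "adj ?G c v" "adj ?G c w" "u \<noteq> v" "v \<noteq> w" "u \<noteq> w" "\<not> adj G c u"
      "\<not> adj ?G u v" "\<not> adj ?G v w" "\<not> adj ?G u w" for c u v w
  proof -
    have "adj G x c" "adj G x u" using a by (auto simp: adj_local_completion)
    moreover have "adj G c v" "adj G c w" using a calculation by (auto simp: adj_local_completion)
    ultimately show ?thesis using core a by blast
  qed
  show ?thesis unfolding claws_heavy_def
  proof (intro allI impI, elim conjE)
    fix c u v w
    assume a: "adj ?G c u" "adj ?G c v" "adj ?G c w" "u \<noteq> v" "v \<noteq> w" "u \<noteq> w"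
      "\<not> adj ?G u v" "\<not> adj ?G v w" "\<not> adj ?G u w"
    show "o_heavy_pair ?G u v \<or> o_heavy_pair ?G v w \<or> o_heavy_pair ?G u w"
    proof (cases "adj G c u \<and> adj G c v \<and> adj G c w")
      case True
      then show ?thesis using claws_heavyD[OF assms(2), of c u v w] a up sub by blast
    next
      case False
      then show ?thesis
        using half[of c u v w] half[of c v u w] half[of c w u v] a
        by (metis adj_sym o_heavy_pair_sym)
    qed
  qed
qed

definition simplicial :: "'a ugraph \<Rightarrow> 'a \<Rightarrow> bool" where
  "simplicial G x \<longleftrightarrow> is_clique G (nbhd G x)"

lemma simplicialD: "simplicial G x \<Longrightarrow> adj G x u \<Longrightarrow> adj G x v \<Longrightarrow> u \<noteq> v \<Longrightarrow> adj G u v"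
  by (auto simp: simplicial_def is_clique_def nbhd_def)

lemma simplicial_local_completion_self:
  "simple_graph G \<Longrightarrow> simplicial (local_completion G x) x"
  by (auto simp: simplicial_def is_clique_def nbhd_def adj_local_completion adj_irrefl)

text \<open>If \<open>c\<close> gains a neighbour, then \<open>x\<close> is an old neighbour of
  \<open>c\<close>, so by simpliciality all other old neighbours of \<open>c\<close> lie in
  \<open>N(x)\<close> and get joined to the new ones.\<close>

lemma simplicial_local_completion:
  assumes "simple_graph G" "simplicial G c"
  shows "simplicial (local_completion G x) c"
  using simplicialD[OF assms(2)] adj_irrefl[OF assms(1)]
  unfolding simplicial_def is_clique_def nbhd_def
  by (simp add: adj_local_completion) (metis adj_sym)

lemma closure_step_invariants:
  assumes "closure_step\<^sup>*\<^sup>* G H" "simple_graph G"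
  shows "simple_graph H \<and> verts H = verts G \<and> (\<forall>u v. adj G u v \<longrightarrow> adj H u v) \<and>
    (claws_heavy G \<longrightarrow> claws_heavy H) \<and> (\<forall>x. simplicial G x \<longrightarrow> simplicial H x)"
  using assms
proof (induction rule: rtranclp_induct)
  case (step G1 G2)
  then obtain x where "G2 = local_completion G1 x" by (auto simp: closure_step_def)
  moreover note step.IH[OF step.prems]
  ultimately show ?case
    by (auto simp: adj_local_completion simple_graph_local_completion
        claws_heavy_local_completion simplicial_local_completion)
qed auto

definition diamond_free :: "'a ugraph \<Rightarrow> bool" where
  "diamond_free G \<longleftrightarrow> (\<forall>u v w w'. adj G u v \<and> adj G u w \<and> adj G v w \<and> adj G u w' \<and> adj G v w' \<and> w \<noteq> w'
     \<longrightarrow> adj G w w')"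

text \<open>A relation rather than a path: linking paths are its reflexive transitive closure, and
  detours are spliced in by monotonicity of that closure.\<close>

definition link_rel :: "'a ugraph \<Rightarrow> 'a ugraph \<Rightarrow> 'a \<Rightarrow> 'a \<Rightarrow> 'a \<Rightarrow> 'a \<Rightarrow> bool" where
  "link_rel G H u v x y \<longleftrightarrow> adj G x y \<and>
     {x, y} \<subseteq> {w. simplicial H w \<and> adj H w u \<and> adj H w v} \<union> {u, v}"

text \<open>
  The centre of a local completion is simplicial from then on, so every edge it adds can be
  replaced by a path of length two through a vertex that is simplicial in the closure.
\<close>
lemma closure_edge_linked:
  assumes "closure_step\<^sup>*\<^sup>* G H" "simple_graph G" "diamond_free H" "adj H u v"
  shows "(link_rel G H u v)\<^sup>*\<^sup>* u v"
  using assms(1,2)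
\<comment> \<open>Completions are peeled off from the front so that \<open>H\<close> stays fixed;
  simpliciality always refers to the final graph.\<close>
proof (induction rule: converse_rtranclp_induct)
  case base
  have "link_rel H H u v u v" using assms(4) by (simp add: link_rel_def)
  then show ?case by blast
next
  case (step G G1)
  obtain c where c: "G1 = local_completion G c" using step.hyps(1) by (auto simp: closure_step_def)
  have s1: "simple_graph G1" unfolding c by (rule simple_graph_local_completion[OF step.prems])
  note inv = closure_step_invariants[OF step.hyps(2) s1]
  note IH = step.IH[OF s1]
  have "simplicial G1 c" unfolding c by (rule simplicial_local_completion_self[OF step.prems])
  then have cs: "simplicial H c" using inv by simp
  have "(link_rel G H u v)\<^sup>*\<^sup>* x y" if r: "link_rel G1 H u v x y" for x y
  proof (cases "adj G x y")
    case True
    then have "link_rel G H u v x y" using r by (simp add: link_rel_def)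
    then show ?thesis by (rule r_into_rtranclp)
  next
    case False
    then have xy: "adj G c x" "adj G c y" "x \<noteq> y"
      using r by (auto simp: link_rel_def c adj_local_completion)
    have GH: "adj H a b" if "adj G a b" for a b
      using that inv by (simp add: c adj_local_completion)
    have hxy: "adj H c x" "adj H c y" "adj H x y"
      using xy GH r inv by (simp_all add: link_rel_def)
    \<comment> \<open>Unless \<open>t\<close> is itself an end of the edge \<open>x y\<close>, both
      \<open>c\<close> and \<open>t\<close> are common neighbours of its ends, so diamond-freeness
      puts \<open>c\<close> into the clique of \<open>u v\<close>.\<close>
    have mem: "c = t \<or> adj H c t" if "t \<in> {u, v}" for t
    proof (cases "t \<in> {x, y}")
      case True
      then show ?thesis using hxy by auto
    next
      case False
      have "adj H x t" "adj H y t"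
        using r that False assms(4) adj_sym[of H u v] unfolding link_rel_def by blast+
      then show ?thesis
        using assms(3) hxy adj_sym[of H c x] adj_sym[of H c y] unfolding diamond_free_def by blast
    qed
    have "c \<in> {w. simplicial H w \<and> adj H w u \<and> adj H w v} \<union> {u, v}"
      using mem[of u] mem[of v] cs by auto
    then have "link_rel G H u v x c" "link_rel G H u v c y"
      using r xy adj_sym[of G c x] unfolding link_rel_def by blast+
    then show ?thesis by (rule converse_rtranclp_into_rtranclp[OF _ r_into_rtranclp])
  qed
  then have "link_rel G1 H u v \<le> (link_rel G H u v)\<^sup>*\<^sup>*" by blast
  from rtranclp_mono[OF this] show ?case using IH by auto
qed

text \<open>
  Heavy claws leave no independent triple in the enriched neighbourhood of \<open>y\<close>, so it is
  disconnected only if it consists of two cliques.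
\<close>
lemma not_eligible_split:
  assumes "simple_graph H" "claws_heavy H" "\<not> c_eligible H y" "\<not> simplicial H y" "y \<in> verts H"
  obtains C D where "C \<union> D = nbhd H y" "C \<inter> D = {}" "C \<noteq> {}" "D \<noteq> {}"
    "is_clique (BC_graph H y) C" "is_clique (BC_graph H y) D"
    "\<And>u v. u \<in> C \<Longrightarrow> v \<in> D \<Longrightarrow> \<not> adj (BC_graph H y) u v"
    "\<And>z p q. o_heavy_pair H y z \<Longrightarrow> p \<in> C \<Longrightarrow> q \<in> D \<Longrightarrow> adj H z p \<Longrightarrow> adj H z q \<Longrightarrow> False"
proof -
  let ?B = "BC_graph H y"
  let ?I = "induced_subgraph ?B (nbhd H y)"
  have nc: "\<not> connected_graph ?I"
    using assms by (auto simp: c_eligible_def simplicial_def)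
  have "nbhd H y \<noteq> {}" using assms(4) by (auto simp: simplicial_def is_clique_def)
  then obtain p q where pq: "p \<in> nbhd H y" "q \<in> nbhd H y" "\<not> (adj ?I)\<^sup>*\<^sup>* p q"
    using nc by (auto simp: connected_graph_def)
  define C where "C = {u \<in> nbhd H y. (adj ?I)\<^sup>*\<^sup>* p u}"
  define D where "D = nbhd H y - C"
  have tri: "adj ?B u v \<or> adj ?B v w \<or> adj ?B u w"
    if "u \<in> nbhd H y" "v \<in> nbhd H y" "w \<in> nbhd H y" "u \<noteq> v" "v \<noteq> w" "u \<noteq> w" for u v w
    using claws_heavyD[OF assms(2), of y u v w] that
    by (auto simp: nbhd_def adj_BC_graph o_heavy_pair_def)
  have sep: "\<not> adj ?B u v" if "u \<in> C" "v \<in> D" for u v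
  proof
    assume "adj ?B u v"
    then have "adj ?I u v" using that by (auto simp: adj_induced_subgraph C_def D_def)
    then have "v \<in> C" using that by (auto simp: C_def D_def intro: rtranclp.rtrancl_into_rtrancl)
    then show False using that by (simp add: D_def)
  qed
  have pC: "p \<in> C" "q \<in> D" using pq by (auto simp: C_def D_def)
  have cC: "is_clique ?B C" unfolding is_clique_def
  proof (intro ballI impI)
    fix u v assume "u \<in> C" "v \<in> C" "u \<noteq> v"
    then show "adj ?B u v"
      using tri[of u v q] sep[of u q] sep[of v q] pC by (auto simp: C_def D_def)
  qed
  have cD: "is_clique ?B D" unfolding is_clique_def
  proof (intro ballI impI)
    fix u v assume "u \<in> D" "v \<in> D" "u \<noteq> v"
    then show "adj ?B u v"
      using tri[of u v p] sep[of p u] sep[of p v] pC adj_sym[of ?B p u] adj_sym[of ?B p v]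
      by (auto simp: C_def D_def)
  qed
  have un: "C \<union> D = nbhd H y" "C \<inter> D = {}" by (auto simp: C_def D_def)
  have heavy: False if "o_heavy_pair H y z" "p \<in> C" "q \<in> D" "adj H z p" "adj H z q" for z p q
  proof -
    have "(\<forall>u\<in>C. \<forall>v\<in>D. \<not> adj ?B u v) \<and> o_heavy_pair H y z \<and>
        (\<exists>p\<in>C. adj H z p) \<and> (\<exists>q\<in>D. adj H z q)"
      using that sep by blast
    then have "\<exists>C\<^sub>1 C\<^sub>2 z. C\<^sub>1 \<union> C\<^sub>2 = nbhd H y \<and> C\<^sub>1 \<inter> C\<^sub>2 = {} \<and>
        is_clique ?B C\<^sub>1 \<and> is_clique ?B C\<^sub>2 \<and> (\<forall>u\<in>C\<^sub>1. \<forall>v\<in>C\<^sub>2. \<not> adj ?B u v) \<and>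
        o_heavy_pair H y z \<and> (\<exists>p\<in>C\<^sub>1. adj H z p) \<and> (\<exists>q\<in>C\<^sub>2. adj H z q)"
      using un cC cD by (intro exI[of _ C] exI[of _ D] exI[of _ z]) simp
    then have "c_eligible H y"
      unfolding c_eligible_def using assms(4,5) by (simp add: simplicial_def)
    then show False using assms(3) by simp
  qed
  have ne: "C \<noteq> {}" "D \<noteq> {}" using pC by auto
  show thesis by (rule that[OF un ne cC cD sep heavy])
qed

text \<open>
  If \<open>{x, z}\<close> were o-heavy, every common neighbour \<open>y\<close> of \<open>x\<close> and \<open>z\<close> would have a neighbour
  outside \<open>N[x] \<union> N[z]\<close>, and these would be distinct for distinct \<open>y\<close>: more vertices than there are.
\<close>
lemma closed_no_o_heavy_pair:
  assumes "simple_graph H" "claws_heavy H" "\<And>x. x \<in> verts H \<Longrightarrow> \<not> c_eligible H x"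
  shows "\<not> o_heavy_pair H x z"
proof
  assume xz: "o_heavy_pair H x z"
  define M where "M = nbhd H x \<inter> nbhd H z"
  have V: "x \<in> verts H" "z \<in> verts H" "x \<noteq> z" "\<not> adj H x z"
    "card (verts H) \<le> deg H x + deg H z"
    using xz by (auto simp: o_heavy_pair_def)
  have finV: "finite (verts H)" using assms(1) by (simp add: simple_graph_def)
  \<comment> \<open>Since \<open>x\<close> is not eligible through the o-heavy pair
    \<open>x z\<close>, the vertex \<open>z\<close> cannot have neighbours in both parts of
    \<open>N(x)\<close>; so all of \<open>M\<close> lies in one enriched clique.\<close>
  have pairs: "adj H m y \<or> o_heavy_pair H m y" if my: "m \<in> M" "y \<in> M" "m \<noteq> y" for m y
  proof (cases "simplicial H x")
    case True
    then show ?thesis using my simplicialD[of H x m y] by (auto simp: M_def nbhd_def)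
  next
    case False
    obtain C D where CD: "C \<union> D = nbhd H x" "C \<inter> D = {}" "C \<noteq> {}" "D \<noteq> {}"
      "is_clique (BC_graph H x) C" "is_clique (BC_graph H x) D"
      "\<And>u v. u \<in> C \<Longrightarrow> v \<in> D \<Longrightarrow> \<not> adj (BC_graph H x) u v"
      "\<And>z p q. o_heavy_pair H x z \<Longrightarrow> p \<in> C \<Longrightarrow> q \<in> D \<Longrightarrow> adj H z p \<Longrightarrow> adj H z q \<Longrightarrow> False"
      by (rule not_eligible_split[OF assms(1,2) assms(3)[OF V(1)] False V(1) that])
    have "adj (BC_graph H x) m y"
      using my CD(1,5,6) CD(8)[OF xz] unfolding M_def nbhd_def is_clique_def by blast
    then show ?thesis
      using my adj_verts[OF assms(1)] unfolding adj_BC_graph o_heavy_pair_def M_def nbhd_def by blast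
  qed
  have E: "\<exists>w. adj H y w \<and> w \<in> verts H \<and> w \<notin> nbhd H x \<union> nbhd H z \<union> {x, z} \<and>
      (\<forall>m\<in>M. adj H m w \<longrightarrow> m = y)"
    if y: "y \<in> M" for y
  proof -
    have yx: "adj H y x" "adj H y z" "y \<in> verts H"
      using y adj_verts[OF assms(1)] by (auto simp: M_def nbhd_def adj_sym)
    have ns: "\<not> simplicial H y" using simplicialD[of H y x z] yx V by blast
    obtain C D where CD: "C \<union> D = nbhd H y" "C \<inter> D = {}" "C \<noteq> {}" "D \<noteq> {}"
      "is_clique (BC_graph H y) C" "is_clique (BC_graph H y) D"
      "\<And>u v. u \<in> C \<Longrightarrow> v \<in> D \<Longrightarrow> \<not> adj (BC_graph H y) u v"
      "\<And>z p q. o_heavy_pair H y z \<Longrightarrow> p \<in> C \<Longrightarrow> q \<in> D \<Longrightarrow> adj H z p \<Longrightarrow> adj H z q \<Longrightarrow> False"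
      by (rule not_eligible_split[OF assms(1,2) assms(3)[OF yx(3)] ns yx(3) that])
    have bxz: "adj (BC_graph H y) x z" using yx V by (auto simp: adj_BC_graph)
    have goal: ?thesis if CD: "C \<union> D = nbhd H y" "C \<inter> D = {}" "D \<noteq> {}" "x \<in> C"
      "\<And>u v. u \<in> C \<Longrightarrow> v \<in> D \<Longrightarrow> \<not> adj (BC_graph H y) u v"
      "\<And>z p q. o_heavy_pair H y z \<Longrightarrow> p \<in> C \<Longrightarrow> q \<in> D \<Longrightarrow> adj H z p \<Longrightarrow> adj H z q \<Longrightarrow> False" for C D
    proof -
      \<comment> \<open>The o-heavy pair \<open>x z\<close> is an edge of the enriched neighbourhood
        of \<open>y\<close>, so both ends lie in the same part; the other part supplies
        \<open>w\<close>.\<close>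
      have zC: "z \<in> C" using CD bxz yx by (auto simp: nbhd_def)
      obtain w where w: "w \<in> D" using CD by blast
      have yw: "adj H y w" using CD w by (auto simp: nbhd_def)
      have "\<not> adj H x w" "\<not> adj H z w"
        using CD(5)[OF _ w] CD(4) zC by (auto simp: adj_BC_graph)
      moreover have "w \<noteq> x" "w \<noteq> z" using w CD zC by auto
      \<comment> \<open>Another \<open>m\<close> adjacent to \<open>w\<close> would join the two
        parts of \<open>N(y)\<close> if it were a neighbour of \<open>y\<close>; otherwise it is an
        o-heavy partner of \<open>y\<close> with neighbours \<open>x\<close> and \<open>w\<close> in
        both parts, which makes \<open>y\<close> eligible.\<close>
      moreover have "m = y" if m: "m \<in> M" "adj H m w" for m
      proof (rule ccontr)
        assume ne: "m \<noteq> y"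
        have mx: "adj H m x" using m by (auto simp: M_def nbhd_def adj_sym)
        consider "adj H y m" | "o_heavy_pair H y m" using pairs[OF m(1) y ne] adj_sym o_heavy_pair_sym by metis
        then show False
        proof cases
          case 1
          then have "m \<in> C \<or> m \<in> D" using CD by (auto simp: nbhd_def)
          then show False using CD(5)[OF _ w, of m] CD(5)[OF CD(4), of m] m mx
            by (auto simp: adj_BC_graph adj_sym)
        next
          case 2
          then show False using CD(6)[OF 2 CD(4) w] mx m by blast
        qed
      qed
      ultimately show ?thesis using yw adj_verts[OF assms(1) yw] by (auto simp: nbhd_def)
    qed
    have "x \<in> C \<or> x \<in> D" using CD(1) yx by (auto simp: nbhd_def)
    then show ?thesis
    proof
      assume "x \<in> C" then show ?thesis by (rule goal[OF CD(1,2,4) _ CD(7,8)])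
    next
      assume "x \<in> D"
      moreover have "\<not> adj (BC_graph H y) u v" if "u \<in> D" "v \<in> C" for u v
        using CD(7)[of v u] that adj_sym[of _ u v] by simp
      moreover have False if "o_heavy_pair H y z" "p \<in> D" "q \<in> C" "adj H z p" "adj H z q" for z p q
        using CD(8)[of z q p] that by simp
      moreover have "D \<union> C = nbhd H y" "D \<inter> C = {}" using CD(1,2) by auto
      ultimately show ?thesis using goal[of D C, OF _ _ CD(3)] by presburger
    qed
  qed
  then obtain f where f: "\<And>y. y \<in> M \<Longrightarrow> adj H y (f y) \<and> f y \<in> verts H \<and>
      f y \<notin> nbhd H x \<union> nbhd H z \<union> {x, z} \<and> (\<forall>m\<in>M. adj H m (f y) \<longrightarrow> m = y)" by metis
  have "inj_on f M" unfolding inj_on_def using f by metis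
  then have cf: "card (f ` M) = card M" by (rule card_image)
  let ?U = "nbhd H x \<union> nbhd H z"
  note fn = finite_nbhd[OF assms(1)]
  have xzU: "x \<notin> ?U" "z \<notin> ?U" using V adj_irrefl[OF assms(1)] by (auto simp: nbhd_def adj_sym)
  have "?U \<union> f ` M \<union> {x, z} \<subseteq> verts H" using f V nbhd_subset_verts[OF assms(1)] by blast
  then have "card (?U \<union> f ` M \<union> {x, z}) \<le> card (verts H)" by (rule card_mono[OF finV])
  moreover have finM: "finite (f ` M)" using fn by (simp add: M_def)
  have "card (?U \<union> f ` M \<union> {x, z}) = card (?U \<union> f ` M) + card {x, z}"
    by (rule card_Un_disjoint) (use fn finM xzU f in auto)
  moreover have "card (?U \<union> f ` M) = card ?U + card (f ` M)"
    by (rule card_Un_disjoint) (use fn finM f in auto)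
  moreover have "card (nbhd H x) + card (nbhd H z) = card ?U + card M"
    unfolding M_def by (rule card_Un_Int[OF fn fn])
  ultimately show False using V(3,5) cf by (simp add: deg_def)
qed

text \<open>Without o-heavy pairs \<open>BC_graph\<close> adds nothing and no claw can be heavy. The
  neighbourhood of a non-simplicial vertex then splits into two cliques with no edges between them,
  so a diamond does not fit.\<close>

lemma closed_claw_diamond_free:
  assumes "simple_graph H" "claws_heavy H" "\<And>x. x \<in> verts H \<Longrightarrow> \<not> c_eligible H x"
  shows "diamond_free H"
    and "adj H c u \<Longrightarrow> adj H c v \<Longrightarrow> adj H c w \<Longrightarrow> u \<noteq> v \<Longrightarrow> v \<noteq> w \<Longrightarrow> u \<noteq> w \<Longrightarrow>
      adj H u v \<or> adj H v w \<or> adj H u w"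
proof -
  note no = closed_no_o_heavy_pair[OF assms]
  have BC: "adj (BC_graph H y) u v \<longleftrightarrow> adj H u v" for y u v
    using no[of u v] adj_verts[OF assms(1)] by (auto simp: adj_BC_graph o_heavy_pair_def)
  show "adj H u v \<or> adj H v w \<or> adj H u w"
    if "adj H c u" "adj H c v" "adj H c w" "u \<noteq> v" "v \<noteq> w" "u \<noteq> w"
    using claws_heavyD[OF assms(2) that] no by blast
  show "diamond_free H" unfolding diamond_free_def
  proof (intro allI impI, elim conjE)
    fix u v w w'
    assume a: "adj H u v" "adj H u w" "adj H v w" "adj H u w'" "adj H v w'" "w \<noteq> w'"
    have uV: "u \<in> verts H" using a adj_verts[OF assms(1)] by blast
    show "adj H w w'"
    proof (cases "simplicial H u")
      case True
      then show ?thesis using simplicialD a by metis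
    next
      case False
      obtain C D where CD: "C \<union> D = nbhd H u" "C \<inter> D = {}" "C \<noteq> {}" "D \<noteq> {}"
      "is_clique (BC_graph H u) C" "is_clique (BC_graph H u) D"
      "\<And>s t. s \<in> C \<Longrightarrow> t \<in> D \<Longrightarrow> \<not> adj (BC_graph H u) s t"
      "\<And>z p q. o_heavy_pair H u z \<Longrightarrow> p \<in> C \<Longrightarrow> q \<in> D \<Longrightarrow> adj H z p \<Longrightarrow> adj H z q \<Longrightarrow> False"
      by (rule not_eligible_split[OF assms(1,2) assms(3)[OF uV] False uV that])
      have "v \<in> C \<union> D" "w \<in> C \<union> D" "w' \<in> C \<union> D" using CD(1) a by (auto simp: nbhd_def)
      then show ?thesis
        using CD(5,6) CD(7)[of v w] CD(7)[of v w'] CD(7)[of w v] CD(7)[of w' v] a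
          adj_sym[of H v w] adj_sym[of H v w'] unfolding BC is_clique_def by blast
    qed
  qed
qed

section \<open>Nets in the closure\<close>

lemma rtranclp_crosses:
  assumes "r\<^sup>*\<^sup>* u v" "u \<in> S" "v \<notin> S"
  shows "\<exists>y z. r y z \<and> y \<in> S \<and> z \<notin> S"
  using assms by (induction rule: rtranclp_induct) blast+

text \<open>A walk of least length: a chord or a repeated vertex would shorten it.\<close>

lemma ex_induced_path:
  assumes "r\<^sup>*\<^sup>* u v"
  obtains m p where "p 0 = u" "p m = v" "\<And>i. i < m \<Longrightarrow> r (p i) (p (Suc i))"
    "\<And>i j. i + 2 \<le> j \<Longrightarrow> j \<le> m \<Longrightarrow> \<not> r (p i) (p j)"
    "\<And>i j. i < j \<Longrightarrow> j \<le> m \<Longrightarrow> p i \<noteq> p j"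
proof -
  have ex: "\<exists>m. (r ^^ m) u v" using assms by (simp add: rtranclp_power)
  define m where "m = (LEAST m. (r ^^ m) u v)"
  have m: "(r ^^ m) u v" using LeastI_ex[OF ex] by (simp add: m_def)
  have least: "m \<le> k" if "(r ^^ k) u v" for k unfolding m_def using that by (rule Least_le)
  obtain p where p: "p 0 = u" "p m = v" "\<And>i. i < m \<Longrightarrow> r (p i) (p (Suc i))"
    using m unfolding relpowp_fun_conv by blast
  have seg: "(r ^^ (j - i)) (p i) (p j)" if "i \<le> j" "j \<le> m" for i j
    unfolding relpowp_fun_conv using that p by (intro exI[of _ "\<lambda>k. p (i + k)"]) auto
  have short: "(r ^^ (i + k + (m - j))) u v" if "i \<le> m" "(r ^^ k) (p i) (p j)" "j \<le> m" for i j k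
  proof -
    have "(r ^^ i) u (p i)" "(r ^^ (m - j)) (p j) v" using seg[of 0 i] seg[of j m] that p by auto
    then have "((r ^^ i) OO (r ^^ k) OO (r ^^ (m - j))) u v" using that(2) by blast
    then show ?thesis by (simp add: relpowp_add relcompp_assoc)
  qed
  have "\<not> r (p i) (p j)" if "i + 2 \<le> j" "j \<le> m" for i j
  proof
    assume "r (p i) (p j)"
    then have "(r ^^ 1) (p i) (p j)" by (simp only: relpowp_1)
    from least[OF short[OF _ this]] that show False by simp
  qed
  moreover have "p i \<noteq> p j" if "i < j" "j \<le> m" for i j
  proof
    assume "p i = p j"
    then have "(r ^^ 0) (p i) (p j)" by simp
    from least[OF short[OF _ this]] that show False by simp
  qed
  ultimately show thesis using that p by blast
qed

text \<open>Exchanging \<open>a\<close> for \<open>w\<close> turns \<open>N(w)\<close> into a subset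
  of \<open>N(a)\<close> of the same size.\<close>

lemma simplicial_deg_le:
  assumes "simple_graph H" "simplicial H w" "adj H w a"
  shows "deg H w \<le> deg H a"
proof -
  have s: "insert w (nbhd H w - {a}) \<subseteq> nbhd H a"
    using assms(3) simplicialD[OF assms(2,3)] by (auto simp: nbhd_def adj_sym)
  have "w \<notin> nbhd H w" "a \<in> nbhd H w"
    using adj_irrefl[OF assms(1)] assms(3) by (auto simp: nbhd_def)
  then have "card (insert w (nbhd H w - {a})) = card (nbhd H w)"
    using finite_nbhd[OF assms(1), of w] by (metis card_insert_disjoint card_Suc_Diff1 finite_Diff DiffD1)
  then show ?thesis using card_mono[OF finite_nbhd[OF assms(1)] s] by (simp add: deg_def)
qed

text \<open>The properties of a closure on which the analysis of nets rests; eligibility and single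
  completions no longer appear in it.\<close>

locale closed_pair =
  fixes G H :: "'a ugraph"
  assumes sG: "simple_graph G" and sH: "simple_graph H" and verts_eq: "verts H = verts G"
    and sub: "adj G u v \<Longrightarrow> adj H u v"
    and claws: "claws_heavy G"
    and dia: "diamond_free H"
    and claw_freeD: "adj H c u \<Longrightarrow> adj H c v \<Longrightarrow> adj H c w \<Longrightarrow> u \<noteq> v \<Longrightarrow> v \<noteq> w \<Longrightarrow> u \<noteq> w \<Longrightarrow>
      adj H u v \<or> adj H v w \<or> adj H u w"
    and noh: "\<not> o_heavy_pair H x z"
    and linked: "adj H u v \<Longrightarrow> (link_rel G H u v)\<^sup>*\<^sup>* u v"
begin

abbreviation "g \<equiv> adj G"
abbreviation "h \<equiv> adj H"
abbreviation "n \<equiv> card (verts G)"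

text \<open>Records nonadjacency in \<open>G\<close> and failure of o-heaviness at once: a pattern
  in \<open>G\<close> all of whose non-edges are light is induced and contains no o-heavy
  pair.\<close>

definition light :: "'a \<Rightarrow> 'a \<Rightarrow> bool" where
  "light u v \<longleftrightarrow> u \<in> verts G \<and> v \<in> verts G \<and> u \<noteq> v \<and> \<not> g u v \<and> deg G u + deg G v < n"

lemma light_sym: "light u v \<Longrightarrow> light v u"
  by (auto simp: light_def adj_sym)

lemma g_sym: "g u v \<Longrightarrow> g v u" and h_sym: "h u v \<Longrightarrow> h v u"
  by (simp_all add: adj_sym)

lemma h_irrefl: "\<not> h u u" and h_verts: "h u v \<Longrightarrow> u \<in> verts G \<and> v \<in> verts G"
  using adj_irrefl[OF sH] adj_verts[OF sH] verts_eq by auto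

lemma deg_le: "deg G u \<le> deg H u"
  by (rule deg_mono[OF sH sub])

lemma lightI: "\<not> h u v \<Longrightarrow> u \<noteq> v \<Longrightarrow> u \<in> verts G \<Longrightarrow> v \<in> verts G \<Longrightarrow> light u v"
  using noh[of u v] deg_le[of u] deg_le[of v] sub[of u v] verts_eq
  by (auto simp: light_def o_heavy_pair_def)

lemma diaD: "h u v \<Longrightarrow> h u w \<Longrightarrow> h v w \<Longrightarrow> h u w' \<Longrightarrow> h v w' \<Longrightarrow> w \<noteq> w' \<Longrightarrow> h w w'"
  using dia unfolding diamond_free_def by blast

lemma claw_light: "g c u \<Longrightarrow> g c v \<Longrightarrow> g c w \<Longrightarrow> light u v \<Longrightarrow> light v w \<Longrightarrow> light u w \<Longrightarrow> False"
  using claws_heavyD[OF claws, of c u v w] by (auto simp: light_def o_heavy_pair_def)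

lemma link_first:
  assumes "h u v"
  shows "\<exists>y. g u y \<and> (y = v \<or> simplicial H y \<and> h y u \<and> h y v)"
proof -
  have "u \<noteq> v" using assms h_irrefl by blast
  then obtain y where "link_rel G H u v u y"
    using linked[OF assms] by (metis converse_rtranclpE)
  moreover have "y \<noteq> u" using calculation adj_irrefl[OF sG] by (auto simp: link_rel_def)
  ultimately show ?thesis by (auto simp: link_rel_def)
qed

text \<open>The linking path from \<open>u\<close> to \<open>v\<close> starts in the closed
  \<open>G\<close>-neighbourhood of \<open>u\<close> and ends outside it; the step that leaves it is
  \<open>y z\<close>.\<close>

lemma link_distance_two:
  assumes "h u v" "\<not> g u v"
  shows "\<exists>y z. g u y \<and> g y z \<and> \<not> g u z \<and> z \<noteq> u \<and> simplicial H y \<and> h y u \<and> h y v \<and>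
    (z = v \<or> simplicial H z \<and> h z u \<and> h z v)"
proof -
  have uv: "u \<noteq> v" using assms h_irrefl by blast
  have "u \<in> insert u (nbhd G u)" "v \<notin> insert u (nbhd G u)" using uv assms by (auto simp: nbhd_def)
  from rtranclp_crosses[OF linked[OF assms(1)] this] obtain y z where
    yz: "link_rel G H u v y z" "y \<in> insert u (nbhd G u)" "z \<notin> insert u (nbhd G u)" by blast
  then have "g u y" "\<not> g u z" "z \<noteq> u" "g y z" by (auto simp: nbhd_def link_rel_def)
  moreover have "y \<noteq> u" "y \<noteq> v" using calculation assms(2) by auto
  ultimately show ?thesis using yz(1) unfolding link_rel_def by blast
qed

section \<open>Nets of \<open>H\<close> and their transfer to \<open>G\<close>\<close>

definition hnet :: "'a \<Rightarrow> 'a \<Rightarrow> 'a \<Rightarrow> 'a \<Rightarrow> 'a \<Rightarrow> 'a \<Rightarrow> bool" where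
  "hnet a b c a' b' c' \<longleftrightarrow> h a b \<and> h b c \<and> h a c \<and> h a a' \<and> h b b' \<and> h c c' \<and>
     \<not> h a b' \<and> \<not> h a c' \<and> \<not> h b a' \<and> \<not> h b c' \<and> \<not> h c a' \<and> \<not> h c b' \<and>
     \<not> h a' b' \<and> \<not> h b' c' \<and> \<not> h a' c'"

lemma hnet_swap: "hnet a b c a' b' c' \<Longrightarrow> hnet b a c b' a' c'"
  and hnet_rotate: "hnet a b c a' b' c' \<Longrightarrow> hnet b c a b' c' a'"
  unfolding hnet_def using h_sym by blast+

lemma hnetD:
  assumes "hnet a b c a' b' c'"
  shows "h a b" "h b c" "h a c" "h a a'" "h b b'" "h c c'"
    "\<not> h a b'" "\<not> h a c'" "\<not> h b a'" "\<not> h b c'" "\<not> h c a'" "\<not> h c b'"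
    "\<not> h a' b'" "\<not> h b' c'" "\<not> h a' c'" "h b a" "h c b" "h c a" "h a' a" "h b' b" "h c' c"
    "\<not> h b' a" "\<not> h c' a" "\<not> h a' b" "\<not> h c' b" "\<not> h a' c" "\<not> h b' c"
    "\<not> h b' a'" "\<not> h c' b'" "\<not> h c' a'"
  using assms unfolding hnet_def by (auto simp: adj_sym)

lemma hnet_distinct:
  assumes "hnet a b c a' b' c'"
  shows "a \<noteq> b" "b \<noteq> c" "a \<noteq> c" "a \<noteq> a'" "a \<noteq> b'" "a \<noteq> c'" "b \<noteq> a'" "b \<noteq> b'" "b \<noteq> c'"
    "c \<noteq> a'" "c \<noteq> b'" "c \<noteq> c'" "a' \<noteq> b'" "b' \<noteq> c'" "a' \<noteq> c'"
  using hnetD[OF assms] h_irrefl by metis+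

lemma hnet_verts:
  assumes "hnet a b c a' b' c'"
  shows "a \<in> verts G" "b \<in> verts G" "c \<in> verts G" "a' \<in> verts G" "b' \<in> verts G" "c' \<in> verts G"
  using hnetD[OF assms] h_verts by blast+

text \<open>The first vertex on the linking path from \<open>a\<close> to \<open>a'\<close> serves
  as the new leg. If it is not \<open>a'\<close>, it is simplicial and adjacent to both
  \<open>a\<close> and \<open>a'\<close>, so it misses \<open>b\<close>, \<open>c\<close> because
  \<open>a'\<close> does and \<open>b'\<close>, \<open>c'\<close> because \<open>a\<close>
  does.\<close>

lemma hnet_replace_leg:
  assumes "hnet a b c a' b' c'"
  shows "\<exists>d. g a d \<and> hnet a b c d b' c'"
proof -
  note N = hnetD[OF assms] hnet_distinct[OF assms]
  obtain y where y: "g a y" "y = a' \<or> simplicial H y \<and> h y a \<and> h y a'"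
    using link_first[OF N(4)] by blast
  show ?thesis
  proof (cases "y = a'")
    case True
    then show ?thesis using y assms by blast
  next
    case False
    then have s: "simplicial H y" "h y a" "h y a'" using y by auto
    have "\<not> h y b" "\<not> h y c" using simplicialD[OF s(1,3)] N by blast+
    moreover have "\<not> h y b'" "\<not> h y c'" using simplicialD[OF s(1,2)] N by blast+
    ultimately have "hnet a b c y b' c'" unfolding hnet_def using N s h_sym by blast
    then show ?thesis using y by blast
  qed
qed

definition gnet :: "'a \<Rightarrow> 'a \<Rightarrow> 'a \<Rightarrow> 'a \<Rightarrow> 'a \<Rightarrow> 'a \<Rightarrow> bool" where
  "gnet a b c a' b' c' \<longleftrightarrow> hnet a b c a' b' c' \<and> g a a' \<and> g b b' \<and> g c c' \<and>
     deg H a + deg H b < n \<and> deg H b + deg H c < n \<and> deg H a + deg H c < n"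

lemma gnet_rotate: "gnet a b c a' b' c' \<Longrightarrow> gnet b c a b' c' a'"
  unfolding gnet_def using hnet_rotate[of a b c a' b' c'] by (simp add: add.commute)

lemma gnet_hnet: "gnet a b c a' b' c' \<Longrightarrow> hnet a b c a' b' c'"
  by (simp add: gnet_def)

lemma ex_gnet:
  assumes "hnet a b c a' b' c'" "deg H a + deg H b < n" "deg H b + deg H c < n" "deg H a + deg H c < n"
  shows "\<exists>a' b' c'. gnet a b c a' b' c'"
proof -
  obtain d where d: "g a d" "hnet a b c d b' c'" using hnet_replace_leg[OF assms(1)] by blast
  obtain e where e: "g b e" "hnet b c a e c' d" using hnet_replace_leg[OF hnet_rotate[OF d(2)]] by blast
  obtain f where f: "g c f" "hnet c a b f d e" using hnet_replace_leg[OF hnet_rotate[OF e(2)]] by blast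
  show ?thesis unfolding gnet_def using d e f hnet_rotate[OF f(2)] assms by blast
qed

text \<open>The part of the clique of the triangle where degrees are under control: its simplicial
  members have degree at most that of each corner.\<close>

definition core :: "'a \<Rightarrow> 'a \<Rightarrow> 'a \<Rightarrow> 'a set" where
  "core a b c = {a, b, c} \<union> {w. simplicial H w \<and> h w a \<and> h w b \<and> h w c}"

text \<open>Two members of the core can be charged to two different corners, whose degrees in
  \<open>H\<close> sum to less than \<open>n\<close>.\<close>

lemma core_light:
  assumes "gnet a b c a' b' c'" "x \<in> core a b c" "y \<in> core a b c" "x \<noteq> y" "\<not> g x y"
  shows "light x y"
proof -
  have d: "deg H a + deg H b < n" "deg H b + deg H c < n" "deg H a + deg H c < n"
    using assms(1) by (auto simp: gnet_def)
  have V: "x \<in> verts G" "y \<in> verts G"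
    using assms(2,3) hnet_verts[OF gnet_hnet[OF assms(1)]] h_verts by (auto simp: core_def)
  have le: "deg H w \<le> deg H t" if "w \<in> core a b c" "w \<notin> {a, b, c}" "t \<in> {a, b, c}" for w t
    using that simplicial_deg_le[OF sH] by (auto simp: core_def)
  have "deg H x + deg H y < n"
  proof (cases "x \<in> {a, b, c}")
    case True
    then show ?thesis using d assms(3,4) le[of y a] le[of y b] le[of y c]
      by (cases "y \<in> {a, b, c}") auto
  next
    case False
    then show ?thesis using d assms(2,3) le[of x a] le[of x b] le[of x c] le[of y a] le[of y b]
      by (cases "y \<in> {a, b, c}") auto
  qed
  then show ?thesis using V assms(4,5) deg_le[of x] deg_le[of y] by (auto simp: light_def)
qed

lemma core_leg_light:
  assumes "hnet a b c a' b' c'" "x \<in> core a b c" "x \<noteq> a"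
  shows "light x a'"
proof -
  note N = hnetD[OF assms(1)] hnet_distinct[OF assms(1)] hnet_verts[OF assms(1)]
  have "\<not> h x a' \<and> x \<noteq> a'"
  proof (cases "x \<in> {b, c}")
    case True
    then show ?thesis using N by auto
  next
    case False
    then have "simplicial H x" "h x b" using assms(2,3) by (auto simp: core_def)
    then show ?thesis using N simplicialD by metis
  qed
  then show ?thesis using lightI[of x a'] assms(2) N h_verts by (auto simp: core_def)
qed

text \<open>By diamond-freeness the simplicial common neighbours of \<open>a\<close> and
  \<open>b\<close> are also adjacent to \<open>c\<close>, so the linking path of \<open>a b\<close>
  stays in the core.\<close>

lemma core_connected:
  assumes "hnet a b c a' b' c'"
  shows "(\<lambda>x y. g x y \<and> x \<in> core a b c \<and> y \<in> core a b c)\<^sup>*\<^sup>* a b"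
proof -
  note N = hnetD[OF assms]
  have "x \<in> core a b c"
    if "x \<in> {w. simplicial H w \<and> h w a \<and> h w b} \<union> {a, b}" for x
    using that diaD[OF N(1), of x c] N h_sym unfolding core_def by blast
  then have "link_rel G H a b \<le> (\<lambda>x y. g x y \<and> x \<in> core a b c \<and> y \<in> core a b c)"
    unfolding link_rel_def by blast
  from rtranclp_mono[OF this] show ?thesis using linked[OF N(1)] by blast
qed

text \<open>A shortest path from \<open>a\<close> to \<open>b\<close> in the core, prolonged by both
  legs. It avoids \<open>c\<close>, since otherwise \<open>c'\<close> and the two path neighbours of
  \<open>c\<close> would be pairwise light leaves of a claw of \<open>G\<close>.\<close>

lemma ex_spine:
  assumes "gnet a b c a' b' c'"
  obtains M R where "3 \<le> M" "R 0 = a'" "R (Suc 0) = a" "R (M - 1) = b" "R M = b'"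
    "\<And>i. i < M \<Longrightarrow> g (R i) (R (Suc i))"
    "\<And>i j. i + 2 \<le> j \<Longrightarrow> j \<le> M \<Longrightarrow> light (R i) (R j)"
    "\<And>i. 0 < i \<Longrightarrow> i < M \<Longrightarrow> R i \<in> core a b c \<and> R i \<noteq> c"
proof -
  note hn = gnet_hnet[OF assms]
  note N = hnetD[OF hn] hnet_distinct[OF hn] hnet_verts[OF hn]
  let ?X = "core a b c"
  obtain m p where p: "p 0 = a" "p m = b" "\<And>i. i < m \<Longrightarrow> g (p i) (p (Suc i)) \<and> p i \<in> ?X \<and> p (Suc i) \<in> ?X"
    "\<And>i j. i + 2 \<le> j \<Longrightarrow> j \<le> m \<Longrightarrow> \<not> (g (p i) (p j) \<and> p i \<in> ?X \<and> p j \<in> ?X)"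
    "\<And>i j. i < j \<Longrightarrow> j \<le> m \<Longrightarrow> p i \<noteq> p j"
    by (rule ex_induced_path[OF core_connected[OF hn] that])
  have m0: "0 < m" using p(1,2) N by (cases m) auto
  have pX: "p i \<in> ?X" if "i \<le> m" for i
    using p(3)[of i] p(2) that by (cases "i = m") (auto simp: core_def)
  have pl: "light (p i) (p j)" if "i + 2 \<le> j" "j \<le> m" for i j
    using core_light[OF assms, of "p i" "p j"] p(4)[OF that] p(5)[of i j] pX[of i] pX[of j] that by auto
  have la: "light (p i) a'" if "0 < i" "i \<le> m" for i
    using core_leg_light[OF hn, of "p i"] pX that p(1) p(5)[of 0 i] by auto
  have cb: "?X = core b a c" by (auto simp: core_def)
  have lb: "light (p i) b'" if "i < m" for i
    using core_leg_light[OF hnet_swap[OF hn], of "p i"] cb pX[of i] that p(2) p(5)[of i m] by auto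
  have cab: "?X = core c a b" by (auto simp: core_def)
  have lc: "light x c'" if "x \<in> ?X" "x \<noteq> c" for x
    using core_leg_light[OF hnet_rotate[OF hnet_rotate[OF hn]], of x] cab that by auto
  have ga: "g a a'" "g b b'" "g c c'" using assms by (auto simp: gnet_def)
  have pc: "p i \<noteq> c" if "i \<le> m" for i
  proof
    assume c: "p i = c"
    then have i: "0 < i" "i < m" using p(1,2) N that by (metis gr0I, metis le_neq_implies_less)
    have "g c (p (i - 1))" "g c (p (Suc i))"
      using p(3)[of "i - 1"] p(3)[of i] i c g_sym by auto
    moreover have "light (p (i - 1)) (p (Suc i))" using pl[of "i - 1" "Suc i"] i by auto
    moreover have "light (p (i - 1)) c'" "light (p (Suc i)) c'"
      using lc[OF pX[of "i - 1"]] lc[OF pX[of "Suc i"]] p(5)[of "i - 1" i] p(5)[of i "Suc i"] c i by auto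
    ultimately show False using claw_light[of c "p (i - 1)" "p (Suc i)" c'] ga by blast
  qed
  \<comment> \<open>Indices shift by one to make room for \<open>a'\<close>, so \<open>b'\<close>
    gets index \<open>m + 2\<close>.\<close>
  define R where "R i = (if i = 0 then a' else if i = m + 2 then b' else p (i - 1))" for i
  have lab: "light a' b'" using lightI[of a' b'] N by blast
  show thesis
  proof (rule that[of "m + 2" R])
    show "g (R i) (R (Suc i))" if "i < m + 2" for i
      using p(1,2) p(3)[of "i - 1"] that ga g_sym m0 by (cases "i = 0"; cases "i = m + 1") (auto simp: R_def)
    show "light (R i) (R j)" if "i + 2 \<le> j" "j \<le> m + 2" for i j
      using that lab light_sym[OF la[of "j - 1"]] lb[of "i - 1"] pl[of "i - 1" "j - 1"] m0
      by (auto simp: R_def)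
    show "R i \<in> ?X \<and> R i \<noteq> c" if "0 < i" "i < m + 2" for i
      using that pX[of "i - 1"] pc[of "i - 1"] by (auto simp: R_def)
  qed (use m0 p in \<open>auto simp: R_def\<close>)
qed

text \<open>
  A third terminal reaches the induced path between the other two in a triangle, since claws
  whose leaves are pairwise light do not exist.
\<close>
lemma ex_spine_triangle:
  assumes "gnet a b c a' b' c'"
  obtains M R j q s where "3 \<le> M" "g a b \<or> 4 \<le> M" "\<And>i. i < M \<Longrightarrow> g (R i) (R (Suc i))"
    "\<And>i j. i + 2 \<le> j \<Longrightarrow> j \<le> M \<Longrightarrow> light (R i) (R j)"
    "1 \<le> j" "j + 2 \<le> M" "g q (R j)" "g q (R (Suc j))" "g q s"
    "\<And>i. i \<le> M \<Longrightarrow> i \<noteq> j \<Longrightarrow> i \<noteq> Suc j \<Longrightarrow> light q (R i)" "\<And>i. i \<le> M \<Longrightarrow> light s (R i)"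
proof -
  note hn = gnet_hnet[OF assms]
  note N = hnetD[OF hn] hnet_distinct[OF hn] hnet_verts[OF hn]
  let ?X = "core a b c"
  obtain M R where R: "3 \<le> M" "R 0 = a'" "R (Suc 0) = a" "R (M - 1) = b" "R M = b'"
    "\<And>i. i < M \<Longrightarrow> g (R i) (R (Suc i))"
    "\<And>i j. i + 2 \<le> j \<Longrightarrow> j \<le> M \<Longrightarrow> light (R i) (R j)"
    "\<And>i. 0 < i \<Longrightarrow> i < M \<Longrightarrow> R i \<in> core a b c \<and> R i \<noteq> c"
    by (rule ex_spine[OF assms that])
  \<comment> \<open>\<open>M = 3\<close> means that the inner path is the single edge
    \<open>a b\<close>; otherwise the spine has at least five vertices, enough for a P5.\<close>
  have M4: "g a b \<or> 4 \<le> M"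
  proof (cases "M = 3")
    case True
    then show ?thesis using R(6)[of 1] R(3,4) by (simp add: numeral_2_eq_2)
  qed (use R in auto)
  define P where "P = R ` {0<..<M}"
  have aP: "a \<in> P" "b \<in> P"
    unfolding P_def using R(1,3,4) image_eqI[of a R "Suc 0"] image_eqI[of b R "M - 1"] by auto
  have PX: "P \<subseteq> ?X - {c}"
  proof
    fix x assume "x \<in> P"
    then obtain i where "x = R i" "0 < i" "i < M" by (auto simp: P_def)
    then show "x \<in> ?X - {c}" using R(8)[of i] by simp
  qed
  then have cP: "c \<notin> P" by blast
  have cb: "?X = core b a c" by (auto simp: core_def)
  have out: "light x (R i)" if o: "x \<in> ?X" "x \<notin> P" "i \<le> M" "i = 0 \<or> i = M \<or> \<not> g x (R i)" for x i
  proof -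
    have ne: "x \<noteq> a" "x \<noteq> b" using o aP by auto
    consider "i = 0" | "i = M" | "0 < i" "i < M" "\<not> g x (R i)" using o(3,4) by linarith
    then show ?thesis
    proof cases
      case 1
      then show ?thesis using core_leg_light[OF hn o(1) ne(1)] R by simp
    next
      case 2
      then show ?thesis using core_leg_light[OF hnet_swap[OF hn], of x] o(1) cb ne R by simp
    next
      case 3
      then have "R i \<in> P" by (auto simp: P_def)
      then show ?thesis using core_light[OF assms o(1), of "R i"] 3 o(2) PX by auto
    qed
  qed
  \<comment> \<open>If \<open>c\<close> has a neighbour on the path, take \<open>q = c\<close> and
    \<open>s = c'\<close>. Otherwise walk from \<open>c\<close> to \<open>a\<close> in the core and
    stop where the walk first gets next to the path: \<open>q\<close> touches the path, its
    predecessor \<open>s\<close> does not.\<close>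
  have "\<exists>q s. q \<in> ?X \<and> q \<notin> P \<and> g q s \<and> (\<exists>t\<in>P. g q t) \<and> (\<forall>i\<le>M. light s (R i))"
  proof (cases "\<exists>t\<in>P. g c t")
    case True
    have cab: "?X = core c a b" by (auto simp: core_def)
    have "light c' (R i)" if i: "i \<le> M" for i
    proof -
      consider "i = 0" | "i = M" | "0 < i" "i < M" using i by linarith
      then show ?thesis
      proof cases
        case 3
        then show ?thesis
          using core_leg_light[OF hnet_rotate[OF hnet_rotate[OF hn]], of "R i"] cab R(8)[of i] light_sym by auto
      qed (use R N lightI[of c' a'] lightI[of c' b'] in auto)
    qed
    moreover have "g c c'" using assms by (simp add: gnet_def)
    ultimately show ?thesis using True cP by (auto simp: core_def)
  next
    case False
    define S where "S = {x. x \<notin> P \<and> \<not> (\<exists>t\<in>P. g x t)}"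
    have conn: "(\<lambda>x y. g x y \<and> x \<in> ?X \<and> y \<in> ?X)\<^sup>*\<^sup>* c a"
    proof -
      have cab: "?X = core c a b" by (auto simp: core_def)
      show ?thesis using core_connected[OF hnet_rotate[OF hnet_rotate[OF hn]]] cab by simp
    qed
    have "c \<in> S" "a \<notin> S" using False cP aP by (auto simp: S_def)
    from rtranclp_crosses[OF conn this] obtain s q where sq: "g s q" "s \<in> ?X" "q \<in> ?X" "s \<in> S" "q \<notin> S"
      by blast
    have "q \<notin> P" using sq by (auto simp: S_def)
    moreover have "\<exists>t\<in>P. g q t" using sq calculation by (auto simp: S_def)
    moreover have "light s (R i)" if "i \<le> M" for i
    proof (rule out[OF sq(2) _ that])
      show "s \<notin> P" using sq(4) by (simp add: S_def)
      show "i = 0 \<or> i = M \<or> \<not> g s (R i)" using sq(4) that by (auto simp: S_def P_def)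
    qed
    ultimately show ?thesis using sq g_sym by blast
  qed
  then obtain q s where q: "q \<in> ?X" "q \<notin> P" "g q s" "\<exists>t\<in>P. g q t" "\<And>i. i \<le> M \<Longrightarrow> light s (R i)"
    by blast
  define j where "j = (LEAST i. 0 < i \<and> i < M \<and> g q (R i))"
  have "\<exists>i. 0 < i \<and> i < M \<and> g q (R i)" using q(4) by (auto simp: P_def)
  from LeastI_ex[OF this] have j: "0 < j" "j < M" "g q (R j)" by (auto simp: j_def)
  have jl: "\<not> g q (R i)" if "0 < i" "i < j" for i
    using not_less_Least[of i "\<lambda>i. 0 < i \<and> i < M \<and> g q (R i)"] that j by (auto simp: j_def)
  have below: "light q (R i)" if "i < j" for i
    using out[OF q(1,2), of i] jl[of i] that j by auto
  \<comment> \<open>At the first contact \<open>R j\<close>, the vertices \<open>q\<close>,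
    \<open>R (j - 1)\<close>, \<open>R (Suc j)\<close> would otherwise be light leaves of a
    claw.\<close>
  have nxt: "Suc j < M \<and> g q (R (Suc j))"
  proof (rule ccontr)
    assume "\<not> ?thesis"
    then have "light q (R (Suc j))" using out[OF q(1,2), of "Suc j"] j by auto
    moreover have "light q (R (j - 1))" using below j by simp
    moreover have "light (R (j - 1)) (R (Suc j))" using R(7)[of "j - 1" "Suc j"] j by simp
    moreover have "g (R j) (R (Suc j))" "g (R j) (R (j - 1))" "g (R j) q"
      using R(6)[of j] R(6)[of "j - 1"] j g_sym by auto
    ultimately show False using claw_light[of "R j" q "R (j - 1)" "R (Suc j)"] by blast
  qed
  \<comment> \<open>A further contact \<open>R i\<close> would give a claw at \<open>q\<close> with
    light leaves \<open>R j\<close>, \<open>R i\<close>, \<open>s\<close>.\<close>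
  have above: "light q (R i)" if "Suc j < i" "i \<le> M" for i
  proof (rule ccontr)
    assume "\<not> light q (R i)"
    then have "g q (R i)" using out[OF q(1,2), of i] that by auto
    then show False
      using claw_light[of q "R j" "R i" s] j(3) q(3) R(7)[of j i] light_sym[OF q(5)[of i]] light_sym[OF q(5)[of j]]
        that j by auto
  qed
  show thesis
  proof (rule that[OF R(1) M4 R(6,7) _ _ j(3) _ q(3)])
    show "light q (R i)" if "i \<le> M" "i \<noteq> j" "i \<noteq> Suc j" for i
      using below[of i] above[of i] that by linarith
  qed (use j nxt q(5) in auto)
qed

text \<open>In this and the next two patterns every non-edge is light, so a copy would be an induced
  subgraph without o-heavy pair. This is the only form in which the hypothesis on \<open>S\<close>
  is used.\<close>

definition no_net :: bool where
  "no_net \<longleftrightarrow> (\<forall>a b c a' b' c'. g a b \<longrightarrow> g b c \<longrightarrow> g a c \<longrightarrow> g a a' \<longrightarrow> g b b' \<longrightarrow> g c c' \<longrightarrow>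
     light a b' \<longrightarrow> light a c' \<longrightarrow> light b a' \<longrightarrow> light b c' \<longrightarrow> light c a' \<longrightarrow> light c b' \<longrightarrow>
     light a' b' \<longrightarrow> light b' c' \<longrightarrow> light a' c' \<longrightarrow> False)"

definition no_P5 :: bool where
  "no_P5 \<longleftrightarrow> (\<forall>p q r s t. g p q \<longrightarrow> g q r \<longrightarrow> g r s \<longrightarrow> g s t \<longrightarrow> light p r \<longrightarrow> light p s \<longrightarrow>
     light p t \<longrightarrow> light q s \<longrightarrow> light q t \<longrightarrow> light r t \<longrightarrow> False)"

definition no_Z2 :: bool where
  "no_Z2 \<longleftrightarrow> (\<forall>x y a b c. g x y \<longrightarrow> g x a \<longrightarrow> g y a \<longrightarrow> g a b \<longrightarrow> g b c \<longrightarrow> light x b \<longrightarrow> light x c \<longrightarrow>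
     light y b \<longrightarrow> light y c \<longrightarrow> light a c \<longrightarrow> False)"

text \<open>The triangle \<open>q\<close>, \<open>R j\<close>, \<open>R (Suc j)\<close> has the legs
  \<open>s\<close>, \<open>R (j - 1)\<close>, \<open>R (j + 2)\<close>.\<close>

lemma gnet_False_if_no_net:
  assumes "gnet a b c a' b' c'" no_net
  shows False
proof -
  obtain M R j q s where *: "3 \<le> M" "g a b \<or> 4 \<le> M" "\<And>i. i < M \<Longrightarrow> g (R i) (R (Suc i))"
    "\<And>i j. i + 2 \<le> j \<Longrightarrow> j \<le> M \<Longrightarrow> light (R i) (R j)"
    "1 \<le> j" "j + 2 \<le> M" "g q (R j)" "g q (R (Suc j))" "g q s"
    "\<And>i. i \<le> M \<Longrightarrow> i \<noteq> j \<Longrightarrow> i \<noteq> Suc j \<Longrightarrow> light q (R i)" "\<And>i. i \<le> M \<Longrightarrow> light s (R i)"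
    by (rule ex_spine_triangle[OF assms(1) that])
  note nn = assms(2)[unfolded no_net_def, rule_format, of "R j" "R (Suc j)" q "R (j - 1)" "R (j + 2)" s]
  show False
  proof (rule nn)
    show "g (R j) (R (j - 1))" using *(3)[of "j - 1"] *(5,6) g_sym by auto
  qed (use * g_sym light_sym *(3)[of "Suc j"] *(4)[of "j - 1"] in auto)
qed

text \<open>If \<open>a b\<close> is missing in \<open>G\<close>, the first five vertices of the
  spine form the path.\<close>

lemma gnet_adj_if_no_P5:
  assumes "gnet a b c a' b' c'" no_P5
  shows "g a b"
proof (rule ccontr)
  assume n: "\<not> g a b"
  obtain M R j q s where *: "3 \<le> M" "g a b \<or> 4 \<le> M" "\<And>i. i < M \<Longrightarrow> g (R i) (R (Suc i))"
    "\<And>i j. i + 2 \<le> j \<Longrightarrow> j \<le> M \<Longrightarrow> light (R i) (R j)"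
    "1 \<le> j" "j + 2 \<le> M" "g q (R j)" "g q (R (Suc j))" "g q s"
    "\<And>i. i \<le> M \<Longrightarrow> i \<noteq> j \<Longrightarrow> i \<noteq> Suc j \<Longrightarrow> light q (R i)" "\<And>i. i \<le> M \<Longrightarrow> light s (R i)"
    by (rule ex_spine_triangle[OF assms(1) that])
  have M: "4 \<le> M" using n * by simp
  note nn = assms(2)[unfolded no_P5_def, rule_format, of "R 0" "R 1" "R 2" "R 3" "R 4"]
  show False
    by (rule nn) (use M *(3)[of 0] *(3)[of 1] *(3)[of 2] *(3)[of 3] *(4) in \<open>auto simp: numeral_eq_Suc\<close>)
qed

text \<open>The triangle on the spine gets a tail of two spine vertices: towards \<open>a'\<close>
  if \<open>j\<close> is at least 2, and otherwise towards \<open>b'\<close>, where \<open>M\<close>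
  being at least 4 leaves room.\<close>

lemma gnet_adj_if_no_Z2:
  assumes "gnet a b c a' b' c'" no_Z2
  shows "g a b"
proof (rule ccontr)
  assume n: "\<not> g a b"
  obtain M R j q s where *: "3 \<le> M" "g a b \<or> 4 \<le> M" "\<And>i. i < M \<Longrightarrow> g (R i) (R (Suc i))"
    "\<And>i j. i + 2 \<le> j \<Longrightarrow> j \<le> M \<Longrightarrow> light (R i) (R j)"
    "1 \<le> j" "j + 2 \<le> M" "g q (R j)" "g q (R (Suc j))" "g q s"
    "\<And>i. i \<le> M \<Longrightarrow> i \<noteq> j \<Longrightarrow> i \<noteq> Suc j \<Longrightarrow> light q (R i)" "\<And>i. i \<le> M \<Longrightarrow> light s (R i)"
    by (rule ex_spine_triangle[OF assms(1) that])
  have M: "4 \<le> M" using n * by simp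
  show False
  proof (cases "2 \<le> j")
    case True
    then obtain k where k: "j = k + 2" by (metis add.commute le_Suc_ex)
    show False
    proof (rule assms(2)[unfolded no_Z2_def, rule_format, of q "R (k + 3)" "R (k + 2)" "R (k + 1)" "R k"])
      show "g q (R (k + 3))" "g q (R (k + 2))" using *(7,8) k by (simp_all add: numeral_eq_Suc)
      show "g (R (k + 3)) (R (k + 2))" "g (R (k + 2)) (R (k + 1))" "g (R (k + 1)) (R k)"
        using *(3)[of "k + 2"] *(3)[of "k + 1"] *(3)[of k] *(6) k g_sym by (simp_all add: numeral_eq_Suc)
    qed (use * k light_sym in auto)
  next
    case False
    then have j: "j = 1" using * by simp
    show False
    proof (rule assms(2)[unfolded no_Z2_def, rule_format, of q "R 1" "R 2" "R 3" "R 4"])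
      show "g q (R 1)" "g q (R 2)" using *(7,8) j by (simp_all add: numeral_eq_Suc)
      show "g (R 1) (R 2)" "g (R 2) (R 3)" "g (R 3) (R 4)"
        using *(3)[of 1] *(3)[of 2] *(3)[of 3] M by (simp_all add: numeral_eq_Suc)
    qed (use * M j in auto)
  qed
qed

end

section \<open>Excluding P5 and Z2\<close>

context closed_pair
begin

text \<open>The vertices other than \<open>a\<close> of the maximal clique of \<open>H\<close> through the edge \<open>a a'\<close>.\<close>
definition side :: "'a \<Rightarrow> 'a \<Rightarrow> 'a \<Rightarrow> bool" where
  "side a a' v \<longleftrightarrow> h a v \<and> (v = a' \<or> h v a')"

lemma side_not_adj:
  assumes "hnet a b c a' b' c'" "side a a' v"
  shows "\<not> h v b" "\<not> h v c" "v \<noteq> b" "v \<noteq> c" "v \<noteq> b'" "v \<noteq> c'"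
proof -
  note N = hnetD[OF assms(1)] hnet_distinct[OF assms(1)]
  have *: "\<not> h v x" if "h a x" "\<not> h a' x" "a' \<noteq> x" for x
    using diaD[of a v a' x] that assms(2) N(4) h_sym unfolding side_def by metis
  show "\<not> h v b" "\<not> h v c" by (rule *; use N in blast)+
  show "v \<noteq> b" "v \<noteq> c" "v \<noteq> b'" "v \<noteq> c'" using assms(2) N unfolding side_def by blast+
qed

lemma side_adj:
  assumes "h a a'" "side a a' u" "side a a' v" "u \<noteq> v"
  shows "h u v"
  using assms diaD[of a a' u v] h_sym unfolding side_def by metis

text \<open>Otherwise \<open>v\<close> would be the centre of a claw of \<open>H\<close> with leaves
  \<open>a\<close>, \<open>b'\<close>, \<open>c'\<close>.\<close>

lemma side_legs:
  assumes "hnet a b c a' b' c'" "side a a' v"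
  shows "\<not> h v b' \<or> \<not> h v c'"
  using claw_freeD[of v a b' c'] hnetD[OF assms(1)] hnet_distinct[OF assms(1)] assms(2) h_sym
  unfolding side_def by metis

text \<open>The neighbours of \<open>a\<close> form two cliques: \<open>v\<close>,
  \<open>a'\<close>, \<open>b\<close> are not the leaves of a claw, and diamond-freeness extends
  adjacency to one of \<open>b\<close>, \<open>c\<close> to the other.\<close>

lemma nbr_cases:
  assumes "hnet a b c a' b' c'" "h a v"
  shows "side a a' v \<or> v = b \<or> v = c \<or> (h v b \<and> h v c)"
proof -
  note N = hnetD[OF assms(1)] hnet_distinct[OF assms(1)]
  have "v = a' \<or> v = b \<or> h v a' \<or> h v b"
    using claw_freeD[of a v a' b] N assms(2) by blast
  moreover have "v = c \<or> h v c" if "h v b"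
    using diaD[of a b v c] that N assms(2) h_sym by metis
  moreover have "v = b \<or> h v b" if "h v c"
    using diaD[of a c v b] that N assms(2) h_sym by metis
  ultimately show ?thesis using assms(2) unfolding side_def by blast
qed

lemma side_if_adj_side:
  assumes "hnet a b c a' b' c'" "side a a' u" "h u v" "h a v"
  shows "side a a' v"
  using diaD[of a u v a'] assms(2-) hnetD(4)[OF assms(1)] h_sym unfolding side_def by metis

lemma simplicial_sideD:
  assumes "side a a' v" "simplicial H v" "h v w" "w \<noteq> a"
  shows "side a a' w"
  using simplicialD[OF assms(2,3), of a] simplicialD[OF assms(2,3), of a'] assms h_sym
  unfolding side_def by metis

definition light_side :: "'a \<Rightarrow> 'a \<Rightarrow> bool" where
  "light_side a a' \<longleftrightarrow> (\<forall>z. side a a' z \<longrightarrow> \<not> g a z \<longrightarrow> light a z)"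

lemma deg_less:
  assumes "h u v" "\<not> g u v"
  shows "deg G u < deg H u"
proof -
  have "nbhd G u \<subset> nbhd H u" using assms sub by (auto simp: nbhd_def)
  then show ?thesis unfolding deg_def by (rule psubset_card_mono[OF finite_nbhd[OF sH]])
qed

lemma nbhd_H_subset: "nbhd H u \<subseteq> verts G"
  using nbhd_subset_verts[OF sH] verts_eq by simp

lemma finite_verts: "finite (verts G)"
  using sG by (simp add: simple_graph_def)

text \<open>
  If two of the three sides contained an o-heavy partner of their corner, the corners and the
  partners would form an induced 4-cycle of \<open>H\<close>; each vertex is adjacent to at most two vertices
  of such a cycle, which bounds the four degrees.
\<close>
lemma light_side_or_legal:
  assumes "gnet a b c a' b' c'"
  shows "light_side a a' \<or> light_side b b'"
proof (rule ccontr)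
  note hn = gnet_hnet[OF assms]
  note N = hnetD[OF hn] hnet_distinct[OF hn] hnet_verts[OF hn]
  assume "\<not> ?thesis"
  then obtain y z where y: "side a a' y" "\<not> g a y" "\<not> light a y"
    and z: "side b b' z" "\<not> g b z" "\<not> light b z"
    unfolding light_side_def by blast
  have hy: "h a y" and hz: "h b z" using y z by (auto simp: side_def)
  \<comment> \<open>The pair sums to at least \<open>n\<close> in \<open>G\<close>, and each end
    gains at least the edge \<open>a y\<close> in \<open>H\<close>; this gives the 2.\<close>
  have "deg H a + deg H y \<ge> n + 2"
    using deg_less[OF hy y(2)] deg_less[OF h_sym[OF hy]] y h_verts[OF hy] h_irrefl hy
    by (auto simp: light_def adj_sym)
  moreover have "deg H b + deg H z \<ge> n + 2"
    using deg_less[OF hz z(2)] deg_less[OF h_sym[OF hz]] z h_verts[OF hz] h_irrefl hz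
    by (auto simp: light_def adj_sym)
  moreover have "deg H a + deg H b < n" using assms by (simp add: gnet_def)
  ultimately have big: "deg H a + deg H y + (deg H b + deg H z) > 2 * n" "deg H y + deg H z \<ge> n" by linarith+
  have yb: "\<not> h y b" "\<not> h b y" using side_not_adj[OF hn y(1)] h_sym by metis+
  have za: "\<not> h z a" "\<not> h a z" using side_not_adj[OF hnet_swap[OF hn] z(1)] h_sym by metis+
  have yz: "y \<noteq> z" using hy za by auto
  \<comment> \<open>As \<open>a\<close> and \<open>b\<close> together have degree below
    \<open>n\<close>, the partners \<open>y\<close> and \<open>z\<close> carry the rest; being too
    heavy to be nonadjacent in \<open>H\<close>, they close the 4-cycle
    \<open>a y z b\<close>.\<close>
  have hyz: "h y z"
    using noh[of y z] big yz h_verts[OF hy] h_verts[OF hz] verts_eq by (auto simp: o_heavy_pair_def)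
  have ne: "y \<noteq> b" "z \<noteq> a" using N yb za hy hz z y by (auto simp: side_def)
  let ?A = "nbhd H a" and ?B = "nbhd H b" and ?Y = "nbhd H y" and ?Z = "nbhd H z"
  \<comment> \<open>A common neighbour of \<open>a\<close> and \<open>y\<close> that sees
    \<open>b\<close> or \<open>z\<close> would, by diamond-freeness, create the chord
    \<open>y b\<close> or \<open>a z\<close>.\<close>
  have d1: "(?A \<inter> ?Y) \<inter> (?B \<union> ?Z) = {}"
  proof -
    have "\<not> h b w \<and> \<not> h z w" if "h a w" "h y w" for w
      using diaD[of a w y b] diaD[of y w a z] that hy hyz yb za ne N(1) h_sym by metis
    then show ?thesis by (auto simp: nbhd_def)
  qed
  have d2: "(?B \<inter> ?Z) \<inter> (?A \<union> ?Y) = {}"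
  proof -
    have "\<not> h a w \<and> \<not> h y w" if "h b w" "h z w" for w
      using diaD[of b w z a] diaD[of z w b y] that hz hyz yb za ne N(16) h_sym by metis
    then show ?thesis by (auto simp: nbhd_def)
  qed
  note fin = finite_nbhd[OF sH]
  have "card (?A \<inter> ?Y) + card (?B \<union> ?Z) \<le> n"
    using card_Un_disjoint[OF _ _ d1] card_mono[OF finite_verts, of "(?A \<inter> ?Y) \<union> (?B \<union> ?Z)"]
      fin nbhd_H_subset by (metis finite_Int finite_UnI le_sup_iff le_infI1)
  moreover have "card (?B \<inter> ?Z) + card (?A \<union> ?Y) \<le> n"
    using card_Un_disjoint[OF _ _ d2] card_mono[OF finite_verts, of "(?B \<inter> ?Z) \<union> (?A \<union> ?Y)"]
      fin nbhd_H_subset by (metis finite_Int finite_UnI le_sup_iff le_infI1)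
  moreover have "card ?A + card ?Y = card (?A \<union> ?Y) + card (?A \<inter> ?Y)"
    "card ?B + card ?Z = card (?B \<union> ?Z) + card (?B \<inter> ?Z)"
    using card_Un_Int[OF fin fin] by auto
  ultimately show False using big(1) by (simp add: deg_def)
qed

section \<open>Excluding P5: paths that leave the triangle through a corner\<close>

definition tnet :: "'a \<Rightarrow> 'a \<Rightarrow> 'a \<Rightarrow> 'a \<Rightarrow> 'a \<Rightarrow> 'a \<Rightarrow> bool" where
  "tnet a b c a' b' c' \<longleftrightarrow> hnet a b c a' b' c' \<and> g a a' \<and> g b b' \<and> g c c' \<and> g a b \<and> g b c \<and> g a c"

lemma tnet_swap: "tnet a b c a' b' c' \<Longrightarrow> tnet b a c b' a' c'"
  and tnet_rotate: "tnet a b c a' b' c' \<Longrightarrow> tnet b c a b' c' a'"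
  unfolding tnet_def using hnet_swap[of a b c a' b' c'] hnet_rotate[of a b c a' b' c'] g_sym by metis+

lemma tnet_swap': "tnet a b c a' b' c' \<Longrightarrow> tnet a c b a' c' b'"
  by (rule tnet_rotate[OF tnet_swap])

lemma tnetD:
  assumes "tnet a b c a' b' c'"
  shows "hnet a b c a' b' c'" "g a a'" "g b b'" "g c c'" "g a b" "g b c" "g a c" "g b a" "g c b" "g c a"
    "g a' a" "g b' b" "g c' c"
  using assms g_sym unfolding tnet_def by metis+

text \<open>The path is \<open>z y a b b'\<close>. Its non-edges other than \<open>z a\<close> are
  non-edges of \<open>H\<close>; lightness of \<open>z a\<close> has to be supplied.\<close>

lemma P5_through_corner:
  assumes no_P5 "tnet a b c a' b' c'" "g z y" "g y a" "light z a"
    "\<not> h z b" "\<not> h z b'" "\<not> h y b" "\<not> h y b'"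
  shows False
proof -
  note T = tnetD[OF assms(2)]
  note N = hnetD[OF T(1)] hnet_distinct[OF T(1)] hnet_verts[OF T(1)]
  have hz: "h z y" using sub[OF assms(3)] .
  have "light z b" "light z b'" "light y b" "light y b'" "light a b'"
    using lightI[of z b] lightI[of z b'] lightI[of y b] lightI[of y b'] lightI[of a b']
      assms(6-9) hz h_sym[OF hz] h_verts[OF hz] N by metis+
  then show False using assms(1)[unfolded no_P5_def, rule_format, of z y a b b'] assms(3,4,5) T by blast
qed

lemma link_distance_two_side:
  assumes "hnet a b c a' b' c'" "side a a' z" "\<not> g a z"
  shows "\<exists>y w. g a y \<and> g y w \<and> \<not> g a w \<and> simplicial H y \<and> side a a' y \<and> side a a' w"
proof -
  have az: "h a z" using assms(2) by (simp add: side_def)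
  obtain y w where yw: "g a y" "g y w" "\<not> g a w" "w \<noteq> a" "simplicial H y" "h y a" "h y z"
    "w = z \<or> simplicial H w \<and> h w a \<and> h w z"
    using link_distance_two[OF az assms(3)] by blast
  have y: "side a a' y" by (rule side_if_adj_side[OF assms(1,2)]) (use yw h_sym in blast)+
  have "side a a' w" by (rule simplicial_sideD[OF y yw(5)]) (use yw sub in blast)+
  then show ?thesis using yw y by blast
qed

text \<open>Otherwise an induced path \<open>a y w\<close> inside the side continues through
  \<open>b\<close> or \<open>c\<close>: \<open>y\<close> is simplicial and misses both
  \<open>b'\<close> and \<open>c'\<close>, and \<open>w\<close> misses at least one of them.\<close>

lemma light_side_adj_if_no_P5:
  assumes no_P5 "tnet a b c a' b' c'" "light_side a a'" "side a a' z"
  shows "g a z"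
proof (rule ccontr)
  note T = tnetD[OF assms(2)]
  note N = hnetD[OF T(1)] hnet_distinct[OF T(1)]
  assume "\<not> g a z"
  then obtain y w where yw: "g a y" "g y w" "\<not> g a w" "simplicial H y" "side a a' y" "side a a' w"
    using link_distance_two_side[OF T(1) assms(4)] by blast
  have "light w a" using assms(3) yw light_sym unfolding light_side_def by metis
  moreover have "\<not> h y b'" "\<not> h y c'"
    using simplicialD[OF yw(4), of a] yw(1) sub h_sym N by metis+
  moreover have "\<not> h w b' \<or> \<not> h w c'" by (rule side_legs[OF T(1) yw(6)])
  ultimately show False
    using P5_through_corner[OF assms(1,2), of w y] P5_through_corner[OF assms(1) tnet_swap'[OF assms(2)], of w y]
      side_not_adj[OF T(1) yw(5)] side_not_adj[OF T(1) yw(6)] yw g_sym by metis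
qed

text \<open>2-connectedness enters here: a path from \<open>a'\<close> to \<open>b\<close> avoiding
  \<open>a\<close> must leave the side, and a neighbour of the side that is adjacent to
  \<open>a\<close> would still belong to it.\<close>

lemma ex_frontier:
  assumes "hnet a b c a' b' c'" "connected_graph (induced_subgraph G (verts G - {a}))"
  shows "\<exists>x w. side a a' x \<and> h x w \<and> w \<noteq> a \<and> \<not> h w a"
proof -
  note N = hnetD[OF assms(1)] hnet_distinct[OF assms(1)] hnet_verts[OF assms(1)]
  have "(adj (induced_subgraph G (verts G - {a})))\<^sup>*\<^sup>* a' b"
    using assms(2) N unfolding connected_graph_def by auto
  from rtranclp_crosses[OF this, of "{v. side a a' v}"] N obtain x w where xw: "adj (induced_subgraph G (verts G - {a})) x w" "side a a' x" "\<not> side a a' w"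
    unfolding side_def by blast
  then have hx: "h x w" "w \<noteq> a" using sub by (auto simp: adj_induced_subgraph)
  moreover have "\<not> h w a" using side_if_adj_side[OF assms(1) xw(2) hx(1)] xw(3) h_sym by metis
  ultimately show ?thesis using xw by blast
qed

text \<open>The path \<open>w x a\<close>, coming from outside the side, is continued by
  \<open>b b'\<close> or \<open>c c'\<close>. What has to be ruled out is that \<open>x\<close> or
  \<open>w\<close> sees the leg in question.\<close>

lemma no_P5_False:
  assumes no_P5 "tnet a b c a' b' c'" "light_side a a'"
    "connected_graph (induced_subgraph G (verts G - {a}))"
  shows False
proof -
  note T = tnetD[OF assms(2)]
  note N = hnetD[OF T(1)] hnet_distinct[OF T(1)] hnet_verts[OF T(1)]
  obtain x w where xw: "side a a' x" "h x w" "w \<noteq> a" "\<not> h w a"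
    using ex_frontier[OF T(1) assms(4)] by blast
  note sx = side_not_adj[OF T(1) xw(1)]
  have gax: "g x a" using light_side_adj_if_no_P5[OF assms(1-3) xw(1)] g_sym by metis
  have P5: False if "g z x" "light z a" "\<not> h z b" "\<not> h z b'" "\<not> h x b'" for z
    using P5_through_corner[OF assms(1,2) that(1) gax that(2,3,4) sx(1) that(5)] .
  have P5': False if "g z x" "light z a" "\<not> h z c" "\<not> h z c'" "\<not> h x c'" for z
    using P5_through_corner[OF assms(1) tnet_swap'[OF assms(2)] that(1) gax that(2,3,4) sx(2) that(5)] .
  \<comment> \<open>If \<open>x t\<close> were not an edge of \<open>G\<close>, the first vertex
    \<open>r\<close> of its linking path would be simplicial, and the path \<open>r x a\<close>
    continues through whichever leg \<open>x\<close> misses.\<close>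
  have out: "g x t" if t: "h x t" "t \<noteq> a" "\<not> h t a" for t
  proof (rule ccontr)
    assume "\<not> g x t"
    then obtain r where r: "g x r" "simplicial H r" "h r x" "h r t" using link_first[OF t(1)] by blast
    have "\<not> h r a" using simplicialD[OF r(2,4), of a] t h_sym by metis
    moreover have "r \<noteq> a" using r t h_sym by metis
    ultimately have "light r a" using lightI h_verts[OF r(3)] N by blast
    moreover have "\<not> h r b" "\<not> h r c" using simplicialD[OF r(2,3)] sx by blast+
    moreover have "\<not> h r b' \<or> h x b'" "\<not> h r c' \<or> h x c'" using simplicialD[OF r(2,3)] sx by blast+
    ultimately show False using P5[of r] P5'[of r] side_legs[OF T(1) xw(1)] g_sym[OF r(1)] by metis
  qed
  \<comment> \<open>If \<open>x\<close> saw the leg \<open>p'\<close>, the path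
    \<open>y x p' p q\<close> would run around and end inside the triangle, where \<open>y\<close>
    is \<open>a'\<close> or a simplicial substitute for it.\<close>
  have no: False if s: "tnet a p q a' p' q'" "h x p'" for p q p' q'
  proof -
    note T' = tnetD[OF s(1)]
    note N' = hnetD[OF T'(1)] hnet_distinct[OF T'(1)] hnet_verts[OF T'(1)]
    note sx' = side_not_adj[OF T'(1) xw(1)]
    have gx: "g x p'" using out[OF s(2)] N' by blast
    have xa: "h x a'" using xw(1) s(2) N' by (auto simp: side_def)
    obtain y where y: "g x y" "y = a' \<or> simplicial H y \<and> h y x \<and> h y a'" using link_first[OF xa] by blast
    have hy: "\<not> h y p'" "\<not> h y p" "\<not> h y q"
      using y(2) simplicialD[of H y a'] N' by blast+
    have yV: "y \<in> verts G" "x \<in> verts G" using h_verts[OF sub[OF y(1)]] by auto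
    have "y \<noteq> p'" "y \<noteq> p" "y \<noteq> q" using y(2) N' by blast+
    then have "light y p'" "light y p" "light y q" using lightI hy yV N' by blast+
    moreover have "light x p" "light x q" "light p' q" using lightI sx' yV N' by blast+
    ultimately show False
      using assms(1)[unfolded no_P5_def, rule_format, of y x p' p q] gx g_sym[OF y(1)] T' by metis
  qed
  have xb: "\<not> h x b'" and xc: "\<not> h x c'" using no assms(2) tnet_swap'[OF assms(2)] by blast+
  have gxw: "g w x" using out xw g_sym by metis
  have wa: "light w a" using lightI xw h_verts[OF xw(2)] N by blast
  \<comment> \<open>Otherwise \<open>x\<close>, \<open>b'\<close>, \<open>c'\<close> are the leaves
    of a claw at \<open>w\<close>. Moreover \<open>w\<close> can see \<open>b\<close> only as a
    member of the side of \<open>b\<close>, hence together with \<open>b'\<close>; likewise for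
    \<open>c\<close>.\<close>
  have "\<not> h w b' \<or> \<not> h w c'"
    using claw_freeD[of w x b' c'] xw(2) xb xc N sx h_sym by metis
  moreover have "h w b'" if "h w b"
    using nbr_cases[OF hnet_swap[OF T(1)], of w] that xw sx xb h_sym unfolding side_def by metis
  moreover have "h w c'" if "h w c"
    using nbr_cases[OF hnet_rotate[OF hnet_rotate[OF T(1)]], of w] that xw sx xc h_sym unfolding side_def by metis
  ultimately show False using P5[OF gxw wa] P5'[OF gxw wa] xb xc by blast
qed

section \<open>Excluding Z2: triangles with a tail at a corner\<close>

lemma Z2_through_corner:
  assumes no_Z2 "tnet a b c a' b' c'" "g a y" "g y z" "light a z"
    "\<not> h y b" "\<not> h y c" "light z b" "light z c"
  shows False
proof -
  note T = tnetD[OF assms(2)]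
  note N = hnetD[OF T(1)] hnet_distinct[OF T(1)] hnet_verts[OF T(1)]
  have "y \<in> verts G" "y \<noteq> b" "y \<noteq> c" using h_verts[OF sub[OF assms(3)]] assms(6,7) N by auto
  then have "light y b" "light y c" using lightI assms(6,7) N by blast+
  then show False
    using assms(1)[unfolded no_Z2_def, rule_format, of b c a y z] assms(3-9) T light_sym by metis
qed

lemma light_side_adj_if_no_Z2:
  assumes no_Z2 "tnet a b c a' b' c'" "light_side a a'" "side a a' z"
  shows "g a z"
proof (rule ccontr)
  note T = tnetD[OF assms(2)]
  note N = hnetD[OF T(1)] hnet_distinct[OF T(1)] hnet_verts[OF T(1)]
  assume "\<not> g a z"
  then obtain y w where yw: "g a y" "g y w" "\<not> g a w" "simplicial H y" "side a a' y" "side a a' w"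
    using link_distance_two_side[OF T(1) assms(4)] by blast
  have "light a w" using assms(3) yw unfolding light_side_def by blast
  moreover have "light w b" "light w c"
    using lightI side_not_adj[OF T(1) yw(6)] h_verts[OF sub[OF yw(2)]] N by blast+
  ultimately show False
    using Z2_through_corner[OF assms(1,2) yw(1,2)] side_not_adj[OF T(1) yw(5)] by blast
qed

lemma Z2_in_side:
  assumes no_Z2 "tnet a b c a' b' c'" "side a a' y" "side a a' z" "g a y" "g a z" "g y z"
    "\<not> h y b'" "\<not> h z b'"
  shows False
proof -
  note T = tnetD[OF assms(2)]
  note N = hnetD[OF T(1)] hnet_distinct[OF T(1)] hnet_verts[OF T(1)]
  note sy = side_not_adj[OF T(1) assms(3)] and sz = side_not_adj[OF T(1) assms(4)]
  have V: "y \<in> verts G" "z \<in> verts G" using h_verts[OF sub[OF assms(7)]] by auto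
  have "light y b" "light y b'" "light z b" "light z b'" "light a b'"
    using lightI sy sz assms(8,9) V N by blast+
  then show False
    using assms(1)[unfolded no_Z2_def, rule_format, of y z a b b'] assms(5-7) T g_sym by metis
qed

text \<open>A second vertex \<open>z\<close> has a \<open>G\<close>-neighbour \<open>y\<close> on
  its way to \<open>a'\<close>; the triangle \<open>a z y\<close> has the tail \<open>b b'\<close>
  or \<open>c c'\<close>, because \<open>y\<close> misses both legs and \<open>z\<close> at least
  one.\<close>

lemma side_singleton_if_no_Z2:
  assumes no_Z2 "tnet a b c a' b' c'" "light_side a a'" "side a a' z"
  shows "z = a'"
proof (rule ccontr)
  note T = tnetD[OF assms(2)]
  note N = hnetD[OF T(1)] hnet_distinct[OF T(1)] hnet_verts[OF T(1)]
  assume ne: "z \<noteq> a'"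
  then have za: "h z a'" using assms(4) by (auto simp: side_def)
  obtain y where y: "g z y" "y = a' \<or> simplicial H y \<and> h y z \<and> h y a'" using link_first[OF za] by blast
  have ya: "y \<noteq> a" using y(2) N simplicialD[of H a a' b] by blast
  have sy: "side a a' y"
    using y(2) diaD[of z a' a y] assms(4) N(4) ya za h_sym unfolding side_def by metis
  have "\<not> h y b'" "\<not> h y c'" using y(2) simplicialD[of H y a'] N by blast+
  moreover have "g a z" "g a y" using light_side_adj_if_no_Z2[OF assms(1-3)] assms(4) sy by blast+
  ultimately show False
    using Z2_in_side[OF assms(1,2,4) sy] Z2_in_side[OF assms(1) tnet_swap'[OF assms(2)] assms(4) sy]
      side_legs[OF T(1) assms(4)] y(1) by blast
qed

text \<open>The triangle \<open>a b c\<close> with tail \<open>a' w\<close> is a Z2 unless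
  \<open>w\<close> lies in the side of \<open>c\<close> and is not light to \<open>c\<close>: the
  sides of \<open>a\<close> and \<open>b\<close> are single vertices and offer no other escape. Two
  such \<open>w\<close> would form a diamond with \<open>a'\<close> and \<open>c\<close>.\<close>

lemma ex_return_vertex:
  assumes no_Z2 "tnet a b c a' b' c'" "light_side a a'" "light_side b b'"
    "connected_graph (induced_subgraph G (verts G - {a}))"
  shows "\<exists>r. g a' r \<and> side c c' r \<and> \<not> light c r \<and> (\<forall>v. h a' v \<longrightarrow> v = a \<or> v = r)"
proof -
  note T = tnetD[OF assms(2)]
  note N = hnetD[OF T(1)] hnet_distinct[OF T(1)] hnet_verts[OF T(1)]
  have single: "z = a'" if "side a a' z" for z
    by (rule side_singleton_if_no_Z2[OF assms(1-3) that])
  have singleb: "z = b'" if "side b b' z" for z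
    by (rule side_singleton_if_no_Z2[OF assms(1) tnet_swap[OF assms(2)] assms(4) that])
  have ret: "g a' w \<and> side c c' w \<and> \<not> light c w" if w: "h a' w" "w \<noteq> a" for w
  proof -
    have wa: "\<not> h w a" using single[of w] w h_irrefl h_sym unfolding side_def by metis
    have no: False if "g a' r" "\<not> h r a" "r \<noteq> a" "light r b" "light r c" for r
    proof -
      have "light a r" using lightI light_sym that h_verts[OF sub[OF that(1)]] N by metis
      then show False
        using Z2_through_corner[OF assms(1,2), of a' r] that T N by blast
    qed
    have g: "g a' w"
    proof (rule ccontr)
      assume "\<not> g a' w"
      then obtain r where r: "g a' r" "simplicial H r" "h r a'" "h r w" using link_first[OF w(1)] by blast
      have "\<not> h r a" using simplicialD[OF r(2,4), of a] w wa by blast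
      moreover have "r \<noteq> a" using r wa h_sym by metis
      moreover have "\<not> h r b" "\<not> h r c" "r \<noteq> b" "r \<noteq> c"
        using simplicialD[OF r(2,3)] r(3) N by blast+
      ultimately show False using no[OF r(1)] lightI h_verts[OF r(3)] N by blast
    qed
    have wb: "\<not> h w b"
      using nbr_cases[OF hnet_swap[OF T(1)], of w] singleb[of w] w wa N h_sym by metis
    have wne: "w \<noteq> b" "w \<noteq> c" using w N by auto
    have "light w b" using lightI wb wne h_verts[OF w(1)] N by blast
    then have nl: "\<not> light w c" using no[OF g wa w(2)] by blast
    then have "h c w" using lightI wne h_verts[OF w(1)] N h_sym by metis
    then have "side c c' w"
      using nbr_cases[OF hnet_rotate[OF hnet_rotate[OF T(1)]], of w] w wa wne by blast
    then show ?thesis using g nl light_sym by metis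
  qed
  obtain x w where xw: "side a a' x" "h x w" "w \<noteq> a" using ex_frontier[OF T(1) assms(5)] by blast
  then have w: "h a' w" "w \<noteq> a" using single by blast+
  have "v = w" if v: "h a' v" "v \<noteq> a" for v
  proof (rule ccontr)
    assume "v \<noteq> w"
    moreover have s: "side c c' v" "side c c' w" using ret v w by blast+
    ultimately have "h v w" using side_adj[of c c' v w] N by blast
    then show False using diaD[of v w a' c] v w s N h_sym unfolding side_def by metis
  qed
  then show ?thesis using ret[OF w] by blast
qed

text \<open>
  The configuration left over by the exclusion of Z2: two of the three sides are single edges
  that return, through one further edge each, to the third side.
\<close>
definition theta :: "'a \<Rightarrow> 'a \<Rightarrow> 'a \<Rightarrow> 'a \<Rightarrow> 'a \<Rightarrow> 'a \<Rightarrow> 'a \<Rightarrow> 'a \<Rightarrow> bool" where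
  "theta a b c a' b' c' r s \<longleftrightarrow> tnet a b c a' b' c' \<and>
     g a' r \<and> side c c' r \<and> \<not> light c r \<and> (\<forall>v. h a' v \<longrightarrow> v = a \<or> v = r) \<and>
     g b' s \<and> side c c' s \<and> \<not> light c s \<and> (\<forall>v. h b' v \<longrightarrow> v = b \<or> v = s)"

lemma theta_swap: "theta a b c a' b' c' r s \<Longrightarrow> theta b a c b' a' c' s r"
  unfolding theta_def using tnet_swap[of a b c a' b' c'] by blast

text \<open>The degree sum equals the size of the union of the neighbourhoods plus that of their
  intersection, and \<open>W\<close> avoids the union. In applications \<open>W\<close> also
  contains \<open>u\<close> and \<open>v\<close>.\<close>

lemma card_le_common_nbrs:
  assumes "n \<le> deg G u + deg G v" "W \<subseteq> verts G" "\<And>w. w \<in> W \<Longrightarrow> \<not> g u w \<and> \<not> g v w"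
  shows "card W \<le> card (nbhd G u \<inter> nbhd G v)"
proof -
  let ?U = "nbhd G u \<union> nbhd G v"
  note fin = finite_nbhd[OF sG] and fW = finite_subset[OF assms(2) finite_verts]
  have "card (W \<union> ?U) = card W + card ?U"
    by (rule card_Un_disjoint) (use fin fW assms(3) in \<open>auto simp: nbhd_def\<close>)
  moreover have "card (W \<union> ?U) \<le> n"
    by (rule card_mono[OF finite_verts]) (use assms(2) nbhd_subset_verts[OF sG] in auto)
  moreover have "card (nbhd G u) + card (nbhd G v) = card ?U + card (nbhd G u \<inter> nbhd G v)"
    by (rule card_Un_Int[OF fin fin])
  ultimately show ?thesis using assms(1) unfolding deg_def by linarith
qed

lemma card_non_nbrs:
  assumes "n \<le> deg G u + deg G v" "W \<subseteq> verts G" "\<And>w. w \<in> W \<Longrightarrow> \<not> g u w \<and> \<not> g v w"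
  shows "2 * card W \<le> n"
proof -
  have le: "card W + deg G x \<le> n" if "\<And>w. w \<in> W \<Longrightarrow> \<not> g x w" for x
  proof -
    have "card (W \<union> nbhd G x) = card W + card (nbhd G x)"
      by (rule card_Un_disjoint)
        (use that finite_nbhd[OF sG] finite_subset[OF assms(2) finite_verts] in \<open>auto simp: nbhd_def\<close>)
    moreover have "card (W \<union> nbhd G x) \<le> n"
      by (rule card_mono[OF finite_verts]) (use assms(2) nbhd_subset_verts[OF sG] in auto)
    ultimately show ?thesis unfolding deg_def by linarith
  qed
  show ?thesis using le[of u] le[of v] assms(1,3) by fastforce
qed

lemma ex_two_if_card:
  assumes "2 \<le> card A"
  shows "\<exists>u v. u \<in> A \<and> v \<in> A \<and> u \<noteq> v"
  using assms by (metis card_le_Suc0_iff_eq card.infinite not_less_eq_eq numeral_2_eq_2 le_zero_eq nat.distinct(1))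

definition side_nbrs :: "'a \<Rightarrow> 'a \<Rightarrow> 'a \<Rightarrow> 'a set" where
  "side_nbrs c c' x = {u. side c c' u \<and> g x u}"

lemma side_nbrs_subset: "side_nbrs c c' x \<subseteq> verts G" and finite_side_nbrs: "finite (side_nbrs c c' x)"
proof -
  show s: "side_nbrs c c' x \<subseteq> verts G" using h_verts by (auto simp: side_nbrs_def side_def)
  show "finite (side_nbrs c c' x)" by (rule finite_subset[OF s finite_verts])
qed

section \<open>Degree counting in the configuration \<open>theta\<close>\<close>

context
  fixes a b c a' b' c' r s
  assumes th: "theta a b c a' b' c' r s" and noZ: no_Z2
begin

abbreviation "A \<equiv> side_nbrs c c' c"
abbreviation "B \<equiv> side_nbrs c c' r"

lemma theta_tnet: "tnet a b c a' b' c'" and theta_r: "g a' r" "side c c' r" "\<not> light c r"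
  and nbr_leg_a: "\<And>v. h a' v \<Longrightarrow> v = a \<or> v = r"
  and theta_s: "g b' s" "side c c' s" "\<not> light c s" and nbr_leg_b: "\<And>v. h b' v \<Longrightarrow> v = b \<or> v = s"
  using th unfolding theta_def by blast+

lemmas theta_tnetD = tnetD[OF theta_tnet]
lemmas theta_facts = hnetD[OF theta_tnetD(1)] hnet_distinct[OF theta_tnetD(1)] hnet_verts[OF theta_tnetD(1)]

lemma theta_hnet: "hnet c a b c' a' b'"
  by (rule hnet_rotate[OF hnet_rotate[OF theta_tnetD(1)]])

lemma theta_sideD:
  assumes "side c c' u"
  shows "\<not> h u a" "\<not> h u b" "u \<noteq> a" "u \<noteq> b" "u \<noteq> a'" "u \<noteq> b'" "u \<in> verts G" "h c u" "u \<noteq> c"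
    "h u a' \<Longrightarrow> u = r" "h u b' \<Longrightarrow> u = s"
  using side_not_adj[OF theta_hnet assms] assms h_verts[of c u] nbr_leg_a[of u] nbr_leg_b[of u] h_sym h_irrefl
  unfolding side_def by metis+

text \<open>A common return vertex would be the centre of a claw of \<open>H\<close> with leaves
  \<open>a'\<close>, \<open>b'\<close>, \<open>c\<close>.\<close>

lemma theta_r_neq_s: "r \<noteq> s"
proof
  assume "r = s"
  then show False
    using claw_freeD[of r a' b' c] sub[OF theta_r(1)] sub[OF theta_s(1)] theta_sideD[OF theta_r(2)] theta_facts h_sym by metis
qed

lemma nbr_return:
  assumes "h r v"
  shows "v = a' \<or> v = c \<or> side c c' v"
proof -
  note sr = theta_sideD[OF theta_r(2)]
  have "v = a' \<or> v = c \<or> h v a' \<or> h v c"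
    using claw_freeD[of r v a' c] assms sub[OF theta_r(1)] sr theta_facts h_sym by metis
  moreover have "v \<noteq> a" "v \<noteq> r" using assms sr h_irrefl by blast+
  moreover have "side c c' v" if "h v c"
    using side_if_adj_side[OF theta_hnet theta_r(2) assms] that h_sym by metis
  ultimately show ?thesis using nbr_leg_a[of v] h_sym by metis
qed

text \<open>The triangle \<open>c u v\<close> has the tail \<open>a a'\<close> unless
  \<open>r\<close> is among \<open>u\<close>, \<open>v\<close>, and the tail \<open>b b'\<close>
  unless \<open>s\<close> is.\<close>

lemma corner_nbrs_edge:
  assumes "u \<in> A" "v \<in> A" "g u v"
  shows "{u, v} = {r, s}"
proof (rule ccontr)
  assume ne: "{u, v} \<noteq> {r, s}"
  have uv: "side c c' u" "side c c' v" "g c u" "g c v" "u \<noteq> v"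
    using assms adj_irrefl[OF sG] by (auto simp: side_nbrs_def)
  then consider "u \<noteq> r" "v \<noteq> r" | "u \<noteq> s" "v \<noteq> s" using ne theta_r_neq_s by blast
  then show False
  proof cases
    case 1
    then show False
      using Z2_in_side[OF noZ tnet_rotate[OF tnet_rotate[OF theta_tnet]] uv(1-4) assms(3)] theta_sideD[OF uv(1)] theta_sideD[OF uv(2)] by blast
  next
    case 2
    then show False
      using Z2_in_side[OF noZ tnet_swap'[OF tnet_rotate[OF tnet_rotate[OF theta_tnet]]] uv(1-4) assms(3)]
        theta_sideD[OF uv(1)] theta_sideD[OF uv(2)] by blast
  qed
qed

text \<open>The triangle \<open>u v r\<close> with tail \<open>a' a\<close> would be a Z2.\<close>

lemma return_nbrs_edge:
  assumes "u \<in> B" "v \<in> B"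
  shows "\<not> g u v"
proof
  assume g: "g u v"
  have uv: "side c c' u" "side c c' v" "g r u" "g r v" "u \<noteq> r" "v \<noteq> r"
    using assms adj_irrefl[OF sG] by (auto simp: side_nbrs_def)
  note su = theta_sideD[OF uv(1)] and sv = theta_sideD[OF uv(2)] and sr = theta_sideD[OF theta_r(2)]
  have "light u a'" "light u a" "light v a'" "light v a" "light r a"
    using lightI su sv sr uv theta_facts by blast+
  then show False
    using noZ[unfolded no_Z2_def, rule_format, of u v r a' a] g uv theta_r theta_tnetD g_sym by metis
qed

text \<open>Otherwise \<open>u\<close>, \<open>v\<close>, \<open>a\<close> are light leaves of a
  claw at \<open>c\<close>.\<close>

lemma corner_nbrs_heavy:
  assumes "u \<in> A" "v \<in> A" "u \<noteq> v" "\<not> g u v"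
  shows "n \<le> deg G u + deg G v"
proof (rule ccontr)
  have uv: "side c c' u" "side c c' v" "g c u" "g c v" using assms by (auto simp: side_nbrs_def)
  note su = theta_sideD[OF uv(1)] and sv = theta_sideD[OF uv(2)]
  assume "\<not> ?thesis"
  then have "light u v" using assms su sv by (simp add: light_def)
  moreover have "light u a" "light v a" using lightI su sv theta_facts by blast+
  ultimately show False using claw_light[of c u v a] uv theta_tnetD by blast
qed

text \<open>Otherwise \<open>u\<close>, \<open>v\<close>, \<open>a'\<close> are light leaves of a
  claw at \<open>r\<close>.\<close>

lemma return_nbrs_heavy:
  assumes "u \<in> B" "v \<in> B" "u \<noteq> v"
  shows "n \<le> deg G u + deg G v"
proof (rule ccontr)
  have uv: "side c c' u" "side c c' v" "g r u" "g r v" "u \<noteq> r" "v \<noteq> r"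
    using assms adj_irrefl[OF sG] by (auto simp: side_nbrs_def)
  note su = theta_sideD[OF uv(1)] and sv = theta_sideD[OF uv(2)]
  assume "\<not> ?thesis"
  then have "light u v" using assms su sv return_nbrs_edge by (simp add: light_def)
  moreover have "light u a'" "light v a'" using lightI su sv uv theta_facts by blast+
  ultimately show False using claw_light[of r u v a'] uv theta_r g_sym by metis
qed

lemma nbhd_return: "nbhd G r \<subseteq> {a', c} \<union> B"
  using nbr_return sub by (auto simp: nbhd_def side_nbrs_def)

text \<open>If \<open>c r\<close> is missing, it is an o-heavy pair of \<open>G\<close>. The common
  non-neighbours \<open>c\<close>, \<open>r\<close>, \<open>b'\<close> force three common neighbours
  in \<open>A\<close> and \<open>B\<close>, two of them different from \<open>s\<close>; these two
  are heavy together but miss almost everything around \<open>c\<close> and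
  \<open>r\<close>.\<close>

lemma return_adj_corner: "g c r"
proof (rule ccontr)
  assume ncr: "\<not> g c r"
  have rA: "r \<notin> A" using ncr by (simp add: side_nbrs_def)
  note sr = theta_sideD[OF theta_r(2)]
  have hv: "n \<le> deg G c + deg G r" using theta_r(3) ncr sr theta_facts by (auto simp: light_def)
  have Nr: "nbhd G r \<subseteq> insert a' B" using nbhd_return ncr g_sym by (auto simp: nbhd_def)
  have com: "nbhd G c \<inter> nbhd G r \<subseteq> A \<inter> B"
    using Nr sub theta_facts by (auto simp: nbhd_def side_nbrs_def)
  have "{c, r, b'} \<subseteq> verts G" using theta_facts sr by auto
  moreover have "\<not> g c w \<and> \<not> g r w" if "w \<in> {c, r, b'}" for w
    using that ncr g_sym adj_irrefl[OF sG] sub[of c b'] sub[of r b'] sr(11) theta_r_neq_s theta_facts by auto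
  ultimately have "card {c, r, b'} \<le> card (nbhd G c \<inter> nbhd G r)"
    using card_le_common_nbrs[OF hv] by blast
  also have "\<dots> \<le> card (A \<inter> B)" by (rule card_mono) (use finite_side_nbrs com in auto)
  finally have "3 \<le> card (A \<inter> B)" using sr theta_facts by (auto split: if_splits)
  then have "2 \<le> card (A \<inter> B - {s})" using finite_side_nbrs by (auto simp: card_Diff_singleton_if)
  then obtain u v where uv: "u \<in> A" "u \<in> B" "u \<noteq> s" "v \<in> A" "v \<in> B" "v \<noteq> s" "u \<noteq> v"
    using ex_two_if_card by blast
  \<comment> \<open>\<open>P\<close> collects the \<open>G\<close>-neighbours of \<open>c\<close>
    outside the side. Both \<open>u\<close> and \<open>v\<close> miss \<open>?W\<close>, so twice
    \<open>card (A \<union> B) + card P + 2\<close> is at most \<open>n\<close>, whereas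
    \<open>c\<close> and \<open>r\<close> together have degree at most
    \<open>card P + card A + card B + 1\<close>.\<close>
  define P where "P = {v. g c v \<and> \<not> side c c' v}"
  have PV: "P \<subseteq> verts G" using sub h_verts by (auto simp: P_def)
  have finP: "finite P" using PV finite_subset[OF _ finite_verts] by blast
  let ?W = "(A \<union> B) \<union> P \<union> {a', b'}"
  have non: "\<not> g x w" if x: "x \<in> A" "x \<in> B" "x \<noteq> s" and w: "w \<in> ?W" for x w
  proof
    assume xw: "g x w"
    have sx: "side c c' x" "x \<noteq> r" using x adj_irrefl[OF sG] by (auto simp: side_nbrs_def)
    have "w \<notin> A" using corner_nbrs_edge[OF x(1) _ xw] rA x by (metis insertI1 insertE singletonD)
    moreover have "w \<notin> B" using return_nbrs_edge x xw by blast
    moreover have "w \<noteq> a'" "w \<noteq> b'" using theta_sideD(10,11)[OF sx(1)] sx(2) x(3) sub[OF xw] by blast+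
    moreover have "w \<notin> P" using side_if_adj_side[OF theta_hnet sx(1) sub[OF xw]] sub by (auto simp: P_def)
    ultimately show False using w by blast
  qed
  have "2 * card ?W \<le> n"
    by (rule card_non_nbrs[OF corner_nbrs_heavy[OF uv(1,4,7) return_nbrs_edge[OF uv(2,5)]]])
      (use side_nbrs_subset PV theta_facts non uv in blast)+
  moreover have "card ?W = card (A \<union> B) + card P + 2"
  proof -
    have "card ?W = card ((A \<union> B) \<union> P) + card {a', b'}"
      by (rule card_Un_disjoint) (use finite_side_nbrs finP theta_sideD(5)[of a'] theta_sideD(6)[of b'] sub[of c] theta_facts in \<open>auto simp: side_nbrs_def P_def\<close>)
    moreover have "card ((A \<union> B) \<union> P) = card (A \<union> B) + card P"
      by (rule card_Un_disjoint) (use finite_side_nbrs finP in \<open>auto simp: side_nbrs_def P_def\<close>)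
    ultimately show ?thesis using theta_facts by simp
  qed
  moreover have "deg G c = card P + card A"
  proof -
    have "nbhd G c = P \<union> A" by (auto simp: nbhd_def P_def side_nbrs_def)
    then show ?thesis unfolding deg_def
      by (simp, intro card_Un_disjoint) (use finite_side_nbrs finP in \<open>auto simp: P_def side_nbrs_def\<close>)
  qed
  moreover have "deg G r \<le> Suc (card B)"
    unfolding deg_def using card_mono[OF _ Nr] card_insert_le_m1[of "Suc (card B)" B a'] finite_side_nbrs by simp
  moreover have "card A \<le> card (A \<union> B)" "card B \<le> card (A \<union> B)"
    by (rule card_mono; use finite_side_nbrs in auto)+
  ultimately show False using hv by linarith
qed

end

text \<open>The same scheme for the pair \<open>r s\<close>, which is heavy if nonadjacent because
  both lie in \<open>?A\<close>: the non-neighbours \<open>r\<close>, \<open>s\<close>,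
  \<open>a\<close>, \<open>b\<close> force two common neighbours besides \<open>c\<close>, and these
  miss \<open>?B\<close>, \<open>?B'\<close> and five further vertices, while \<open>r\<close> and
  \<open>s\<close> each have at most two neighbours outside \<open>?B\<close> and
  \<open>?B'\<close>, respectively.\<close>

lemma return_adj_return:
  assumes th: "theta a b c a' b' c' r s" and noZ: no_Z2
  shows "g r s"
proof (rule ccontr)
  note th' = theta_swap[OF th]
  note D = theta_facts[OF th noZ]
  note sr = theta_sideD[OF th noZ theta_r(2)[OF th noZ]] and ss = theta_sideD[OF th noZ theta_s(2)[OF th noZ]]
  note rs = theta_r_neq_s[OF th noZ]
  let ?A = "side_nbrs c c' c" and ?B = "side_nbrs c c' r" and ?B' = "side_nbrs c c' s"
  assume nrs: "\<not> g r s"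
  have A: "r \<in> ?A" "s \<in> ?A"
    using return_adj_corner[OF th noZ] return_adj_corner[OF th' noZ] theta_r(2)[OF th noZ] theta_s(2)[OF th noZ]
    by (auto simp: side_nbrs_def)
  note hv = corner_nbrs_heavy[OF th noZ A rs nrs]
  note Nr = nbhd_return[OF th noZ] and Ns = nbhd_return[OF th' noZ]
  note fin = finite_side_nbrs
  have com: "nbhd G r \<inter> nbhd G s \<subseteq> insert c (?B \<inter> ?B')"
  proof
    fix v assume "v \<in> nbhd G r \<inter> nbhd G s"
    then have v: "g r v" "g s v" by (auto simp: nbhd_def)
    have "v \<noteq> a'" using v(2) sub[of s v] ss(10) rs by blast
    then have "v = c \<or> side c c' v" using nbr_return[OF th noZ sub[OF v(1)]] by blast
    then show "v \<in> insert c (?B \<inter> ?B')" using v by (auto simp: side_nbrs_def)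
  qed
  have "{r, s, a, b} \<subseteq> verts G" using D sr(7) ss(7) by auto
  moreover have "\<not> g r w \<and> \<not> g s w" if "w \<in> {r, s, a, b}" for w
    using that nrs g_sym[of s r] adj_irrefl[OF sG] sub[of r a] sub[of r b] sub[of s a] sub[of s b]
      sr(1,2) ss(1,2) by blast
  ultimately have "card {r, s, a, b} \<le> card (nbhd G r \<inter> nbhd G s)"
    using card_le_common_nbrs[OF hv] by blast
  also have "\<dots> \<le> card (insert c (?B \<inter> ?B'))" by (rule card_mono) (use fin com in auto)
  also have "\<dots> \<le> Suc (card (?B \<inter> ?B'))" by (simp add: card_insert_if fin)
  finally have "2 \<le> card (?B \<inter> ?B')" using sr(3,4) ss(3,4) rs D by (auto split: if_splits)
  then obtain u v where uv: "u \<in> ?B" "u \<in> ?B'" "v \<in> ?B" "v \<in> ?B'" "u \<noteq> v"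
    using ex_two_if_card by blast
  let ?W = "(?B \<union> ?B') \<union> {a, b, a', b', c}"
  have non: "\<not> g x w" if x: "x \<in> ?B" "x \<in> ?B'" and w: "w \<in> ?W" for x w
  proof
    assume xw: "g x w"
    have sx: "side c c' x" "g r x" "x \<noteq> r" "x \<noteq> s"
      using x adj_irrefl[OF sG] by (auto simp: side_nbrs_def)
    note sd = theta_sideD[OF th noZ sx(1)]
    have "w \<notin> ?B" "w \<notin> ?B'"
      using return_nbrs_edge[OF th noZ x(1)] return_nbrs_edge[OF th' noZ x(2)] xw by blast+
    moreover have "w \<noteq> a" "w \<noteq> b" "w \<noteq> a'" "w \<noteq> b'" using sd(1,2,10,11) sx sub[OF xw] by blast+
    moreover have "w \<noteq> c"
    proof
      assume "w = c"
      then have "x \<in> ?A" using xw g_sym sx(1) by (auto simp: side_nbrs_def)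
      from corner_nbrs_edge[OF th noZ A(1) this sx(2)] show False using sx by auto
    qed
    ultimately show False using w by blast
  qed
  have "2 * card ?W \<le> n"
  proof (rule card_non_nbrs[OF return_nbrs_heavy[OF th noZ uv(1,3,5)]])
    show "?W \<subseteq> verts G" using side_nbrs_subset[of c c'] D by auto
    show "\<not> g u w \<and> \<not> g v w" if "w \<in> ?W" for w using non uv that by blast
  qed
  moreover have "card ?W = card (?B \<union> ?B') + card {a, b, a', b', c}"
    by (rule card_Un_disjoint) (use fin theta_sideD(3)[OF th noZ, of a] theta_sideD(4)[OF th noZ, of b]
      theta_sideD(5)[OF th noZ, of a'] theta_sideD(6)[OF th noZ, of b'] theta_sideD(9)[OF th noZ, of c] in \<open>auto simp: side_nbrs_def\<close>)
  moreover have "card {a, b, a', b', c} = 5" using D by auto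
  moreover have le: "card ({x, y} \<union> Z) \<le> 2 + card Z" if "finite Z" for x y :: 'a and Z
    using that by (simp add: card_insert_if)
  have "deg G r \<le> 2 + card ?B" "deg G s \<le> 2 + card ?B'"
    unfolding deg_def using card_mono[OF _ Nr] card_mono[OF _ Ns] le[OF fin] fin
    by (meson finite.emptyI finite_UnI finite_insert le_trans)+
  moreover have "card ?B \<le> card (?B \<union> ?B')" "card ?B' \<le> card (?B \<union> ?B')"
    by (rule card_mono; use fin in auto)+
  ultimately show False using hv by linarith
qed

text \<open>Both \<open>u\<close> and \<open>s\<close> are \<open>G\<close>-neighbours of
  \<open>r\<close> in the side, hence heavy together. They miss \<open>?B\<close> and three more
  vertices, so they have many common neighbours, which apart from \<open>c\<close> and
  \<open>r\<close> lie in \<open>?B'\<close>. The strict inequality is meant to clash with its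
  mirror image.\<close>

lemma return_nbrs_card_less:
  assumes th: "theta a b c a' b' c' r s" and noZ: no_Z2
    and u: "u \<in> side_nbrs c c' r - {s}"
  shows "card (side_nbrs c c' r - {s}) < card (side_nbrs c c' s - {r})"
proof -
  note th' = theta_swap[OF th]
  note D = theta_facts[OF th noZ]
  note sr = theta_sideD[OF th noZ theta_r(2)[OF th noZ]] and ss = theta_sideD[OF th noZ theta_s(2)[OF th noZ]]
  note rs = theta_r_neq_s[OF th noZ]
  let ?B = "side_nbrs c c' r" and ?B' = "side_nbrs c c' s"
  note grs = return_adj_return[OF th noZ]
  note fin = finite_side_nbrs
  have su: "side c c' u" "g r u" "u \<noteq> r" "u \<noteq> s"
    using u adj_irrefl[OF sG] by (auto simp: side_nbrs_def)
  note sd = theta_sideD[OF th noZ su(1)]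
  have sB: "s \<in> ?B" "u \<in> ?B" using grs theta_s(2)[OF th noZ] u by (auto simp: side_nbrs_def)
  note hv = return_nbrs_heavy[OF th noZ sB(2,1) su(4)]
  let ?W = "(?B - {s}) \<union> {s, a, b, a'}"
  have "?W \<subseteq> verts G" using side_nbrs_subset[of c c'] D ss(7) by auto
  moreover have "\<not> g u w \<and> \<not> g s w" if "w \<in> ?W" for w
  proof -
    have "\<not> g u a" "\<not> g u b" "\<not> g u a'" "\<not> g s a" "\<not> g s b" "\<not> g s a'"
      using sd(1,2,10) ss(1,2,10) su(3) rs sub by blast+
    then show ?thesis using return_nbrs_edge[OF th noZ sB(1)] return_nbrs_edge[OF th noZ sB(2)] sB that by blast
  qed
  ultimately have "card ?W \<le> card (nbhd G u \<inter> nbhd G s)"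
    using card_le_common_nbrs[OF hv] by blast
  moreover have "card ?W = card (?B - {s}) + card {s, a, b, a'}"
    by (rule card_Un_disjoint) (use fin theta_sideD(3)[OF th noZ, of a] theta_sideD(4)[OF th noZ, of b]
      theta_sideD(5)[OF th noZ, of a'] in \<open>auto simp: side_nbrs_def\<close>)
  moreover have "card {s, a, b, a'} = 4" using D ss(3-5) by auto
  moreover have "nbhd G u \<inter> nbhd G s \<subseteq> {c, r} \<union> (?B' - {r})"
  proof -
    have "\<not> g u b'" using sd(11) su(4) sub by blast
    then show ?thesis using nbhd_return[OF th' noZ] by (auto simp: nbhd_def)
  qed
  then have "card (nbhd G u \<inter> nbhd G s) \<le> card ({c, r} \<union> (?B' - {r}))"
    by (rule card_mono[rotated]) (use fin in auto)
  moreover have "card ({c, r} \<union> (?B' - {r})) \<le> card {c, r} + card (?B' - {r})" by (rule card_Un_le)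
  moreover have "card {c, r} \<le> 2" by (simp add: card_insert_if)
  ultimately show ?thesis by linarith
qed

text \<open>The pair \<open>c' r\<close> is nonadjacent and heavy, so it has a common neighbour
  besides \<open>c\<close>; this makes \<open>?C\<close> nonempty. Then \<open>?C\<close> is smaller
  than \<open>?C'\<close>, which is therefore nonempty too, and the mirrored inequality contradicts
  the first.\<close>

lemma no_theta:
  assumes th: "theta a b c a' b' c' r s" and noZ: no_Z2
  shows False
proof -
  note th' = theta_swap[OF th]
  note D = theta_facts[OF th noZ]
  note sr = theta_sideD[OF th noZ theta_r(2)[OF th noZ]]
  let ?A = "side_nbrs c c' c"
  let ?C = "side_nbrs c c' r - {s}" and ?C' = "side_nbrs c c' s - {r}"
  have A: "r \<in> ?A" "s \<in> ?A" "c' \<in> ?A"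
    using return_adj_corner[OF th noZ] return_adj_corner[OF th' noZ] theta_r(2)[OF th noZ] theta_s(2)[OF th noZ]
      D theta_tnetD(4)[OF th noZ] by (auto simp: side_nbrs_def side_def)
  have ne: "c' \<noteq> r" "c' \<noteq> s"
    using D sub[OF theta_r(1)[OF th noZ]] sub[OF theta_s(1)[OF th noZ]] by blast+
  have nc: "\<not> g c' r" "\<not> g c' s"
    using corner_nbrs_edge[OF th noZ A(3,1)] corner_nbrs_edge[OF th noZ A(3,2)] ne by blast+
  have "card {c', r} \<le> card (nbhd G c' \<inter> nbhd G r)"
  proof (rule card_le_common_nbrs[OF corner_nbrs_heavy[OF th noZ A(3,1) ne(1) nc(1)]])
    show "{c', r} \<subseteq> verts G" using D sr by auto
    show "\<not> g c' w \<and> \<not> g r w" if "w \<in> {c', r}" for w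
      using that nc g_sym[of r c'] adj_irrefl[OF sG] by blast
  qed
  moreover have "nbhd G c' \<inter> nbhd G r \<subseteq> insert c ?C"
  proof -
    have "\<not> g c' a'" using D sub by blast
    then show ?thesis using nbhd_return[OF th noZ] nc by (auto simp: nbhd_def)
  qed
  then have "card (nbhd G c' \<inter> nbhd G r) \<le> card (insert c ?C)"
    by (rule card_mono[rotated]) (simp add: finite_side_nbrs)
  moreover have "card (insert c ?C) \<le> Suc (card ?C)"
    by (simp add: card_insert_if finite_side_nbrs)
  ultimately have "0 < card ?C" using ne by simp
  then obtain u where "u \<in> ?C" by (metis card_gt_0_iff ex_in_conv)
  from return_nbrs_card_less[OF th noZ this] have less: "card ?C < card ?C'" .
  then have "0 < card ?C'" by simp
  then obtain v where "v \<in> ?C'" by (metis card_gt_0_iff ex_in_conv)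
  from return_nbrs_card_less[OF th' noZ this] less show False by simp
qed

lemma no_Z2_False:
  assumes no_Z2 "tnet a b c a' b' c'" "light_side a a'" "light_side b b'"
    "connected_graph (induced_subgraph G (verts G - {a}))"
    "connected_graph (induced_subgraph G (verts G - {b}))"
  shows False
proof -
  obtain r where r: "g a' r \<and> side c c' r \<and> \<not> light c r \<and> (\<forall>v. h a' v \<longrightarrow> v = a \<or> v = r)"
    using ex_return_vertex[OF assms(1-5)] by blast
  obtain s where s: "g b' s \<and> side c c' s \<and> \<not> light c s \<and> (\<forall>v. h b' v \<longrightarrow> v = b \<or> v = s)"
    using ex_return_vertex[OF assms(1) tnet_swap[OF assms(2)] assms(4,3,6)] by blast
  have "theta a b c a' b' c' r s" unfolding theta_def using assms(2) r s by blast
  then show False using no_theta assms(1) by blast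
qed

lemma hnet_False:
  assumes "hnet a b c a' b' c'" "deg H a + deg H b < n" "deg H b + deg H c < n" "deg H a + deg H c < n"
    and conn: "\<And>v. v \<in> verts G \<Longrightarrow> connected_graph (induced_subgraph G (verts G - {v}))"
    and excl: "no_net \<or> no_P5 \<or> no_Z2"
  shows False
proof -
  obtain a' b' c' where gn: "gnet a b c a' b' c'" using ex_gnet[OF assms(1-4)] by blast
  note gn2 = gnet_rotate[OF gn] and gn3 = gnet_rotate[OF gnet_rotate[OF gn]]
  note V = hnet_verts[OF gnet_hnet[OF gn]]
  have light_side: "light_side a a' \<or> light_side b b'" "light_side b b' \<or> light_side c c'" "light_side c c' \<or> light_side a a'"
    using light_side_or_legal gn gn2 gn3 by blast+
  have tn: "tnet a b c a' b' c'" if "no_P5 \<or> no_Z2"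
  proof -
    have "g a b" "g b c" "g c a"
      using that gnet_adj_if_no_P5 gnet_adj_if_no_Z2 gn gn2 gn3 by blast+
    then show ?thesis using gn g_sym[of c a] unfolding tnet_def gnet_def by blast
  qed
  consider no_net | no_P5 | no_Z2 using excl by blast
  then show False
  proof cases
    case 1
    then show False using gnet_False_if_no_net gn by blast
  next
    case 2
    then have t: "tnet a b c a' b' c'" using tn by blast
    show False
      using light_side(1) no_P5_False[OF 2 t _ conn[OF V(1)]] no_P5_False[OF 2 tnet_swap[OF t] _ conn[OF V(2)]] by blast
  next
    case 3
    then have t: "tnet a b c a' b' c'" using tn by blast
    note t2 = tnet_rotate[OF t] and t3 = tnet_rotate[OF tnet_rotate[OF t]]
    show False
      using light_side no_Z2_False[OF 3 t _ _ conn[OF V(1)] conn[OF V(2)]]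
        no_Z2_False[OF 3 t2 _ _ conn[OF V(2)] conn[OF V(3)]]
        no_Z2_False[OF 3 t3 _ _ conn[OF V(3)] conn[OF V(1)]] by blast
  qed
qed

end

section \<open>The induced subgraphs in the hypothesis\<close>

lemma path_graph_4: "path_graph 4 = \<lparr>verts = {0, 1, 2, 3}, edges = {{0, 1}, {1, 2}, {2, 3}}\<rparr>"
  and path_graph_5: "path_graph 5 = \<lparr>verts = {0, 1, 2, 3, 4}, edges = {{0, 1}, {1, 2}, {2, 3}, {3, 4}}\<rparr>"
  and cycle_graph_3: "cycle_graph 3 = \<lparr>verts = {0, 1, 2}, edges = {{0, 1}, {1, 2}, {0, 2}}\<rparr>"
  and Z_graph_1: "Z_graph 1 = \<lparr>verts = {0, 1, 2, 3}, edges = {{0, 1}, {1, 2}, {0, 2}, {2, 3}}\<rparr>"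
  and Z_graph_2: "Z_graph 2 = \<lparr>verts = {0, 1, 2, 3, 4}, edges = {{0, 1}, {1, 2}, {0, 2}, {2, 3}, {3, 4}}\<rparr>"
proof -
  have *: "{f i |i. P i} = f ` {i. P i}" for f :: "nat \<Rightarrow> nat set" and P by blast
  have v: "{..<3} = {0, 1, 2::nat}" "{..<4} = {0, 1, 2, 3::nat}" "{..<5} = {0, 1, 2, 3, 4::nat}" by auto
  have "{i::nat. Suc i < 4} = {0, 1, 2}" "{i::nat. Suc i < 5} = {0, 1, 2, 3}" by auto
  then show "path_graph 4 = \<lparr>verts = {0, 1, 2, 3}, edges = {{0, 1}, {1, 2}, {2, 3}}\<rparr>"
    "path_graph 5 = \<lparr>verts = {0, 1, 2, 3, 4}, edges = {{0, 1}, {1, 2}, {2, 3}, {3, 4}}\<rparr>"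
    unfolding path_graph_def * v by (simp_all add: eval_nat_numeral)
  have "{i::nat. i < 3} = {0, 1, 2}" by auto
  moreover have "Suc 0 mod 3 = 1" "Suc 1 mod 3 = 2" "Suc 2 mod 3 = 0" by simp_all
  ultimately show "cycle_graph 3 = \<lparr>verts = {0, 1, 2}, edges = {{0, 1}, {1, 2}, {0, 2}}\<rparr>"
    unfolding cycle_graph_def * v by (simp only: image_insert image_empty insert_commute[of 2 "0::nat"])
  have z: "{i::nat. 2 \<le> i \<and> i < 1 + 2} = {2}" "{i::nat. 2 \<le> i \<and> i < 2 + 2} = {2, 3}"
    "1 + 3 = (4::nat)" "2 + 3 = (5::nat)" by auto
  show "Z_graph 1 = \<lparr>verts = {0, 1, 2, 3}, edges = {{0, 1}, {1, 2}, {0, 2}, {2, 3}}\<rparr>"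
    unfolding Z_graph_def * z v by (simp, blast)
  have "{{0, 1}, {1, 2}, {0, 2}} \<union> (\<lambda>i. {i, Suc i}) ` {2, 3} = {{0, 1}, {1, 2}, {0, 2}, {2, 3}, {3, 4 :: nat}}"
    by (simp, blast)
  then show "Z_graph 2 = \<lparr>verts = {0, 1, 2, 3, 4}, edges = {{0, 1}, {1, 2}, {0, 2}, {2, 3}, {3, 4}}\<rparr>"
    unfolding Z_graph_def * z v by (simp only:)
qed

context closed_pair
begin

text \<open>Only pairs with \<open>i < j\<close> are tested, so that a concrete pattern needs each
  fact in one orientation. Injectivity of \<open>f\<close> comes for free, since edges and light
  pairs both have distinct ends.\<close>

lemma no_light_copy:
  fixes P :: "nat ugraph"
  assumes "o_heavy P G" "\<forall>i\<in>verts P. f i \<in> verts G \<and> \<not> adj P i i"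
    and "\<forall>i\<in>verts P. \<forall>j\<in>verts P. i < j \<longrightarrow> (if adj P i j then g (f i) (f j) else light (f i) (f j))"
  shows False
proof -
  have both: "if adj P i j then g (f i) (f j) else light (f i) (f j)"
    if "i \<in> verts P" "j \<in> verts P" "i \<noteq> j" for i j
    using assms(3)[rule_format, of i j] assms(3)[rule_format, of j i] that adj_sym[of P i j] g_sym[of "f j" "f i"] light_sym[of "f j" "f i"]
    by (cases "i < j") (auto split: if_splits)
  have "\<exists>i\<in>verts P. \<exists>j\<in>verts P. o_heavy_pair G (f i) (f j)"
  proof (rule o_heavyD[OF assms(1)])
    show "inj_on f (verts P)"
    proof (rule inj_onI, rule ccontr)
      fix i j assume "i \<in> verts P" "j \<in> verts P" "f i = f j" "i \<noteq> j"
      then show False using both[of i j] adj_irrefl[OF sG] by (auto simp: light_def split: if_splits)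
    qed
    show "adj G (f i) (f j) \<longleftrightarrow> adj P i j" if "i \<in> verts P" "j \<in> verts P" for i j
      using both[OF that] assms(2)[rule_format, OF that(1)] adj_irrefl[OF sG]
      by (cases "i = j") (auto simp: light_def split: if_splits)
  qed (use assms(2) in blast)
  then obtain i j where ij: "i \<in> verts P" "j \<in> verts P" "o_heavy_pair G (f i) (f j)" by blast
  then show False
    using both[of i j] by (cases "i = j") (auto simp: o_heavy_pair_def light_def split: if_splits)
qed

lemma g_verts: "g u v \<Longrightarrow> u \<in> verts G \<and> v \<in> verts G"
  using adj_verts[OF sG] .

lemma no_P5_if_o_heavy:
  assumes "o_heavy (path_graph 5) G"
  shows no_P5
  unfolding no_P5_def
proof (intro allI impI)
  fix p q r s t
  assume *: "g p q" "g q r" "g r s" "g s t" "light p r" "light p s" "light p t" "light q s"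
    "light q t" "light r t"
  show False
    by (rule no_light_copy[OF assms, of "(!) [p, q, r, s, t]"])
      (simp_all add: * g_verts[OF *(1)] g_verts[OF *(2)] g_verts[OF *(4)] path_graph_5
        adj_def[of "\<lparr>verts = _, edges = _\<rparr>"] doubleton_eq_iff)
qed

lemma no_Z2_if_o_heavy:
  assumes "o_heavy (Z_graph 2) G"
  shows no_Z2
  unfolding no_Z2_def
proof (intro allI impI)
  fix x y a b c
  assume *: "g x y" "g x a" "g y a" "g a b" "g b c" "light x b" "light x c" "light y b" "light y c" "light a c"
  show False
    by (rule no_light_copy[OF assms, of "(!) [x, y, a, b, c]"])
      (simp_all add: * g_verts[OF *(1)] g_verts[OF *(2)] g_verts[OF *(5)] Z_graph_2
        adj_def[of "\<lparr>verts = _, edges = _\<rparr>"] doubleton_eq_iff)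
qed

lemma no_net_if_o_heavy:
  assumes "S \<in> {path_graph 4, cycle_graph 3, Z_graph 1, bull, net}" "o_heavy S G"
  shows no_net
  unfolding no_net_def
proof (intro allI impI)
  fix a b c a' b' c'
  assume *: "g a b" "g b c" "g a c" "g a a'" "g b b'" "g c c'" "light a b'" "light a c'" "light b a'"
    "light b c'" "light c a'" "light c b'" "light a' b'" "light b' c'" "light a' c'"
  \<comment> \<open>The copy \<open>a', a, b, b'\<close> of the path traverses its first leg
    backwards, which requires these two facts in reversed orientation.\<close>
  note facts = * *(4)[THEN g_sym] *(9)[THEN light_sym]
  note V = g_verts[OF *(4)] g_verts[OF *(5)] g_verts[OF *(6)]
  note pattern = adj_def[of "\<lparr>verts = _, edges = _\<rparr>"] doubleton_eq_iff
  consider "S = path_graph 4" | "S = cycle_graph 3" | "S = Z_graph 1" | "S = bull" | "S = net"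
    using assms(1) by blast
  then show False
  proof cases
    case 1
    show False
      by (rule no_light_copy[OF assms(2), of "(!) [a', a, b, b']"])
        (simp_all add: facts V 1 path_graph_4 pattern)
  next
    case 2
    show False
      by (rule no_light_copy[OF assms(2), of "(!) [a, b, c]"])
        (simp_all add: facts V 2 cycle_graph_3 pattern)
  next
    case 3
    show False
      by (rule no_light_copy[OF assms(2), of "(!) [a, b, c, c']"])
        (simp_all add: facts V 3 Z_graph_1[simplified] pattern)
  next
    case 4
    show False
      by (rule no_light_copy[OF assms(2), of "(!) [a, b, c, a', b']"])
        (simp_all add: facts V 4 bull_def pattern)
  next
    case 5
    show False
      by (rule no_light_copy[OF assms(2), of "(!) [a, b, c, a', b', c']"])
        (simp_all add: facts V 5 net_def pattern)
  qed
qed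

lemma claw_free_H: "claw_free H"
  unfolding claw_free_def
proof (intro allI impI notI)
  fix A assume "isomorphic claw (induced_subgraph H A)"
  then obtain f where f: "graph_iso f claw (induced_subgraph H A)" by (auto simp: isomorphic_def)
  have inj: "inj_on f {0, 1, 2, 3}" and im: "f ` {0, 1, 2, 3} = A"
    and ad: "\<And>i j. i \<in> {0, 1, 2, 3} \<Longrightarrow> j \<in> {0, 1, 2, 3} \<Longrightarrow>
      adj (induced_subgraph H A) (f i) (f j) \<longleftrightarrow> adj claw i j"
    using f unfolding graph_iso_def bij_betw_def verts_induced_subgraph by (simp_all only: claw_def ugraph.simps)
  have A: "f 0 \<in> A" "f 1 \<in> A" "f 2 \<in> A" "f 3 \<in> A" using im by blast+
  have "h (f 0) (f 1)" "h (f 0) (f 2)" "h (f 0) (f 3)" "\<not> h (f 1) (f 2)" "\<not> h (f 2) (f 3)" "\<not> h (f 1) (f 3)"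
    using ad[of 0 1] ad[of 0 2] ad[of 0 3] ad[of 1 2] ad[of 2 3] ad[of 1 3] A
    by (simp_all add: adj_induced_subgraph claw_def adj_def[of "\<lparr>verts = _, edges = _\<rparr>"] doubleton_eq_iff)
  moreover have "f 1 \<noteq> f 2" "f 2 \<noteq> f 3" "f 1 \<noteq> f 3"
    using inj_onD[OF inj, of 1 2] inj_onD[OF inj, of 2 3] inj_onD[OF inj, of 1 3] by auto
  ultimately show False using claw_freeD by blast
qed

lemma N_p_heavy_H:
  assumes "\<And>v. v \<in> verts G \<Longrightarrow> connected_graph (induced_subgraph G (verts G - {v}))"
    and "no_net \<or> no_P5 \<or> no_Z2"
  shows "N_p_heavy H"
  unfolding N_p_heavy_def
proof (intro allI impI, rule ccontr)
  fix A f
  assume f: "graph_iso f net (induced_subgraph H A)"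
    and light: "\<not> (\<exists>i\<in>{0, 1, 2}. \<exists>j\<in>{0, 1, 2}. a_heavy_pair H (f i) (f j))"
  let ?I = "{0, 1, 2, 3, 4, 5} :: nat set"
  have im: "f ` ?I = A"
    and ad: "\<And>i j. i \<in> ?I \<Longrightarrow> j \<in> ?I \<Longrightarrow> adj (induced_subgraph H A) (f i) (f j) \<longleftrightarrow> adj net i j"
    using f unfolding graph_iso_def bij_betw_def verts_induced_subgraph by (simp_all only: net_def ugraph.simps)
  have ad': "h (f i) (f j) \<longleftrightarrow> adj net i j" if "i \<in> ?I" "j \<in> ?I" for i j
    using ad[OF that] im that by (auto simp: adj_induced_subgraph)
  have hn: "hnet (f 0) (f 1) (f 2) (f 3) (f 4) (f 5)"
    unfolding hnet_def
    by (simp add: ad') (simp add: net_def adj_def doubleton_eq_iff)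
  have "deg H (f 0) + deg H (f 1) < n" "deg H (f 1) + deg H (f 2) < n" "deg H (f 0) + deg H (f 2) < n"
    using light hnetD(1-3)[OF hn] verts_eq by (auto simp: a_heavy_pair_def)
  then show False using hnet_False[OF hn _ _ _ assms] by blast
qed

end

theorem theorem11:
  fixes G clG :: "'a ugraph" and S :: "nat ugraph"
  assumes "simple_graph G"
    and "two_connected G"
    and "S \<in> {path_graph 4, path_graph 5, cycle_graph 3, Z_graph 1, Z_graph 2, bull, net}"
    and "family_o_heavy {claw, S} G"
    and "is_cl_c G clG"
  shows "claw_free clG \<and> N_p_heavy clG"
proof -
  have steps: "closure_step\<^sup>*\<^sup>* G clG" and final: "\<And>x. x \<in> verts clG \<Longrightarrow> \<not> c_eligible clG x"
    using assms(5) by (auto simp: is_cl_c_def)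
  have heavy: "o_heavy claw G" "o_heavy S G" using assms(4) by (auto simp: family_o_heavy_def)
  have cG: "claws_heavy G" by (rule claws_heavy_if_o_heavy_claw[OF assms(1) heavy(1)])
  note inv = closure_step_invariants[OF steps assms(1)]
  have s: "simple_graph clG" and cH: "claws_heavy clG" using inv cG by blast+
  note dia = closed_claw_diamond_free(1)[OF s cH final]
  interpret closed_pair G clG
  proof
    show "(link_rel G clG u v)\<^sup>*\<^sup>* u v" if "adj clG u v" for u v
      by (rule closure_edge_linked[OF steps assms(1) dia that])
    show "\<not> o_heavy_pair clG x z" for x z by (rule closed_no_o_heavy_pair[OF s cH final])
    show "adj clG u v \<or> adj clG v w \<or> adj clG u w"
      if "adj clG c u" "adj clG c v" "adj clG c w" "u \<noteq> v" "v \<noteq> w" "u \<noteq> w" for c u v w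
      by (rule closed_claw_diamond_free(2)[OF s cH final that])
  qed (use assms(1) inv s cG dia in blast)+
  have "no_net \<or> no_P5 \<or> no_Z2"
    using assms(3) heavy(2) no_net_if_o_heavy no_P5_if_o_heavy no_Z2_if_o_heavy by blast
  moreover have "connected_graph (induced_subgraph G (verts G - {v}))" if "v \<in> verts G" for v
    using assms(2) that by (simp add: two_connected_def)
  ultimately show ?thesis using claw_free_H N_p_heavy_H by blast
qed

end
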